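(* Assume that $V'$ is globally Lipschitz continuous. Then the drift-preserving scheme $$\Psi_{n+1}=p_n+\Sigma\Delta W_n-\frac h2\int_0^1V'(q_n+sh\Psi_{n+1})\,ds,\quad q_{n+1}=q_n+h\Psi_{n+1},\quad p_{n+1}=p_n+\Sigma\Delta W_n-h\int_0^1V'(q_n+sh\Psi_{n+1})\,ds$$ converges weakly with order $1$ to the solution $(p(t),q(t))$ of $$dq(t)=p(t)\,dt,\qquad dp(t)=-V'(q(t))\,dt+\Sigma\,dW(t),\qquad (p(0),q(0))=(p_0,q_0),$$ on any finite time interval $[0,T]$. More specifically, for all differentiable test functions $f\colon\mathbb R^{2m}\to\mathbb R$ with $f'$ of polynomial growth there exist $C>0$ and $h^*>0$ such that for all $0<h\le h^*$ and corresponding $n=1,\dots,N$ with $hN=T$, $$\left|\mathbb E[f(p(t_n),q(t_n))]-\mathbb E[f(p_n,q_n)]\right|\le Ch,\qquad t_n=nh.$$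
   Context: Let $T>0$, let $m,d$ be positive integers, $(\Omega,\mathcal F,\mathbb P)$ a probability space with a normal filtration $(\mathcal F_t)_{t\in[0,T]}$, and $W$ a standard $\mathbb R^d$-valued $(\mathcal F_t)$-Brownian motion with continuous sample paths. $V\colon\mathbb R^m\to\mathbb R$ is a smooth potential with gradient $V'$, $H(p,q)=\frac12\sum_{j=1}^m p_j^2+V(q)$ is the associated separable Hamiltonian, and $\Sigma\in\mathbb R^{m\times d}$ is a constant matrix. The initial values $(p_0,q_0)$ have finite expected energy, $\mathbb E[H(p_0,q_0)]<+\infty$. Here $h>0$ is the step size of the scheme, which starts from $(p_0,q_0)$, and $\Delta W_n=W(t_{n+1})-W(t_n)$ are the Wiener increments.
   Formalization: The formal theorem additionally assumes that (p_0,q_0) has a finite moment of order k+1, where f' grows at most like 1+|x|^k; finite expected energy alone does not suffice: some test functions have infinite expectations, and for others the O(h) bound fails. *)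

theory Defs
  imports "HOL-Probability.Probability"
begin

text \<open>In finite dimension a function is of class \<open>C\<^sup>k\<^sup>+\<^sup>1\<close> iff it is differentiable and every
  directional derivative is of class \<open>C\<^sup>k\<close>.\<close>

fun higher_differentiable ::
  "nat \<Rightarrow> ('a::euclidean_space \<Rightarrow> 'b::real_normed_vector) \<Rightarrow> bool" where
  "higher_differentiable 0 f \<longleftrightarrow> continuous_on UNIV f"
| "higher_differentiable (Suc k) f \<longleftrightarrow>
     (\<forall>x. f differentiable (at x)) \<and>
     (\<forall>v. higher_differentiable k (\<lambda>x. frechet_derivative f (at x) v))"

definition smooth :: "('a::euclidean_space \<Rightarrow> 'b::real_normed_vector) \<Rightarrow> bool" where
  "smooth f \<longleftrightarrow> (\<forall>k. higher_differentiable k f)"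

definition hamiltonian :: "(real^'m \<Rightarrow> real) \<Rightarrow> real^'m \<Rightarrow> real^'m \<Rightarrow> real" where
  "hamiltonian V p q = (1/2) * (\<Sum>j\<in>UNIV. (p $ j)\<^sup>2) + V q"

text \<open>This gives \<open>\<bar>f x\<bar> \<le> K' * (1 + norm x ^ (k + 1))\<close> for differentiable \<open>f\<close>.  So a moment of order
  \<open>k + 1\<close> of the initial value is what expectations of all such \<open>f\<close> require; the finite expected
  energy alone does not provide it.\<close>

definition derivative_poly_growth :: "nat \<Rightarrow> ('a::euclidean_space \<Rightarrow> real) \<Rightarrow> bool" where
  "derivative_poly_growth k f \<longleftrightarrow>
     (\<exists>K. \<forall>x. onorm (frechet_derivative f (at x)) \<le> K * (1 + norm x ^ k))"

text \<open>The filtration is indexed by the times in \<open>{0..T}\<close> only; values of \<open>F\<close> at other reals are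
  irrelevant.  ``Normal'' means complete (all null sets of \<open>M\<close> lie in \<open>F 0\<close>) and right-continuous.\<close>

definition normal_filtration :: "'a measure \<Rightarrow> real \<Rightarrow> (real \<Rightarrow> 'a measure) \<Rightarrow> bool" where
  "normal_filtration M T F \<longleftrightarrow>
     (\<forall>t\<in>{0..T}. subalgebra M (F t)) \<and>
     (\<forall>s\<in>{0..T}. \<forall>t\<in>{s..T}. sets (F s) \<subseteq> sets (F t)) \<and>
     null_sets M \<subseteq> sets (F 0) \<and>
     (\<forall>t\<in>{0..<T}. sets (F t) = (\<Inter>s\<in>{t<..T}. sets (F s)))"

text \<open>The last two conjuncts say that the increment over \<open>{s..t}\<close> is centred Gaussian with
  covariance matrix \<open>t - s\<close> times the identity.\<close>

definition brownian_motion ::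
  "'a measure \<Rightarrow> real \<Rightarrow> (real \<Rightarrow> 'a measure) \<Rightarrow> (real \<Rightarrow> 'a \<Rightarrow> real^'d) \<Rightarrow> bool" where
  "brownian_motion M T F W \<longleftrightarrow>
     (\<forall>t\<in>{0..T}. W t \<in> borel_measurable (F t)) \<and>
     (\<forall>\<omega>\<in>space M. continuous_on {0..T} (\<lambda>t. W t \<omega>)) \<and>
     (AE \<omega> in M. W 0 \<omega> = 0) \<and>
     (\<forall>s t. 0 \<le> s \<and> s < t \<and> t \<le> T \<longrightarrow>
        prob_space.indep_set M (sets (F s))
          (sets (vimage_algebra (space M) (\<lambda>\<omega>. W t \<omega> - W s \<omega>) borel)) \<and>
        prob_space.indep_vars M (\<lambda>_. borel) (\<lambda>i \<omega>. (W t \<omega> - W s \<omega>) $ i) UNIV \<and>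
        (\<forall>i. distributed M lborel (\<lambda>\<omega>. (W t \<omega> - W s \<omega>) $ i)
               (\<lambda>x. ennreal (normal_density 0 (sqrt (t - s)) x))))"

text \<open>\<open>dV\<close> is the gradient of the potential.  As \<open>\<Sigma>\<close> is constant, the Ito integral of \<open>\<Sigma>\<close> with
  respect to \<open>W\<close> over \<open>{0..t}\<close> is the integral of a simple (constant) integrand, that is
  \<open>\<Sigma> *v (W t \<omega> - W 0 \<omega>)\<close>.\<close>

definition sde_solution ::
  "'a measure \<Rightarrow> real \<Rightarrow> (real \<Rightarrow> 'a measure) \<Rightarrow> (real \<Rightarrow> 'a \<Rightarrow> real^'d) \<Rightarrow>
   (real^'m \<Rightarrow> real^'m) \<Rightarrow> real^'d^'m \<Rightarrow> ('a \<Rightarrow> real^'m) \<Rightarrow> ('a \<Rightarrow> real^'m) \<Rightarrow>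
   (real \<Rightarrow> 'a \<Rightarrow> real^'m) \<Rightarrow> (real \<Rightarrow> 'a \<Rightarrow> real^'m) \<Rightarrow> bool" where
  "sde_solution M T F W dV \<Sigma> p0 q0 p q \<longleftrightarrow>
     (\<forall>t\<in>{0..T}. p t \<in> borel_measurable (F t) \<and> q t \<in> borel_measurable (F t)) \<and>
     (AE \<omega> in M.
        continuous_on {0..T} (\<lambda>t. p t \<omega>) \<and> continuous_on {0..T} (\<lambda>t. q t \<omega>) \<and>
        (\<forall>t\<in>{0..T}.
           q t \<omega> = q0 \<omega> + integral {0..t} (\<lambda>s. p s \<omega>) \<and>
           p t \<omega> = p0 \<omega> - integral {0..t} (\<lambda>s. dV (q s \<omega>)) + \<Sigma> *v (W t \<omega> - W 0 \<omega>)))"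

text \<open>\<open>N\<close> steps of size \<open>h\<close> of the drift-preserving scheme on the grid \<open>n * h\<close>.  The scheme is
  implicit in \<open>Psi (Suc n)\<close>; the value \<open>Psi 0\<close> plays no role.\<close>

definition drift_preserving_scheme ::
  "'a measure \<Rightarrow> (real \<Rightarrow> 'a \<Rightarrow> real^'d) \<Rightarrow> (real^'m \<Rightarrow> real^'m) \<Rightarrow> real^'d^'m \<Rightarrow>
   ('a \<Rightarrow> real^'m) \<Rightarrow> ('a \<Rightarrow> real^'m) \<Rightarrow> real \<Rightarrow> nat \<Rightarrow>
   (nat \<Rightarrow> 'a \<Rightarrow> real^'m) \<Rightarrow> (nat \<Rightarrow> 'a \<Rightarrow> real^'m) \<Rightarrow> (nat \<Rightarrow> 'a \<Rightarrow> real^'m) \<Rightarrow> bool" where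
  "drift_preserving_scheme M W dV \<Sigma> p0 q0 h N Psi P Q \<longleftrightarrow>
     (\<forall>n\<le>N. P n \<in> borel_measurable M \<and> Q n \<in> borel_measurable M) \<and>
     (\<forall>n<N. Psi (Suc n) \<in> borel_measurable M) \<and>
     (AE \<omega> in M. P 0 \<omega> = p0 \<omega> \<and> Q 0 \<omega> = q0 \<omega>) \<and>
     (\<forall>n<N. AE \<omega> in M.
        let \<Delta>W = W (real (Suc n) * h) \<omega> - W (real n * h) \<omega>;
            I = integral {0..1} (\<lambda>s. dV (Q n \<omega> + (s * h) *\<^sub>R Psi (Suc n) \<omega>))
        in Psi (Suc n) \<omega> = P n \<omega> + \<Sigma> *v \<Delta>W - (h / 2) *\<^sub>R I \<and>
           Q (Suc n) \<omega> = Q n \<omega> + h *\<^sub>R Psi (Suc n) \<omega> \<and>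
           P (Suc n) \<omega> = P n \<omega> + \<Sigma> *v \<Delta>W - h *\<^sub>R I)"

end

theory Submission
  imports Defs
begin

text \<open>As the noise is additive, \<open>p - \<Sigma> W\<close> and \<open>q\<close> are, path by path, differentiable functions of time, and
  the weak estimate follows from a strong one. In a pathwise comparison all local errors are \<open>O(h\<^sup>2)\<close> in
  the mean, except the defect of the right-endpoint rule for the time integral of \<open>\<Sigma> W\<close>, which is only
  \<open>O(h powr (3/2))\<close>. Summed over the first \<open>n\<close> steps this defect equals \<open>h\<close> times the average over
  \<open>u \<in> {0..h}\<close> of the sum over \<open>i < n\<close> of \<open>\<Sigma> (W (i h + u) - W (i h + h))\<close>. For fixed \<open>u\<close> these increments are
  independent, so the sum is Gaussian with covariance \<open>n (h - u) \<Sigma> \<Sigma>\<^sup>T\<close>, where \<open>n (h - u) \<le> T\<close>;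
  Jensen's inequality then bounds all moments of the average uniformly in \<open>h\<close> and \<open>n\<close>. Gronwall's
  inequality gives \<open>\<bar>x - y\<bar> \<le> C h Z\<close> and \<open>\<bar>x\<bar> + \<bar>y\<bar> \<le> C Z\<close> for the exact and the numerical state, with a
  random variable \<open>Z\<close> that has a moment of order \<open>k + 1\<close> bounded independently of \<open>h\<close>, and the mean
  value theorem turns this into \<open>\<bar>f x - f y\<bar> \<le> C h Z ^ (k + 1)\<close>.\<close>

subsection \<open>Pathwise error analysis\<close>

text \<open>With the integrating factor \<open>exp (- (b * s))\<close>, the integral inequality says
  that \<open>G\<close> has a nonpositive derivative, so \<open>G t <= G 0 = a\<close>.\<close>

lemma gronwall_integral:
  fixes u :: "real \<Rightarrow> real"
  assumes cont: "continuous_on {0..T} u" and b: "0 \<le> b"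
    and le: "\<And>t. t \<in> {0..T} \<Longrightarrow> u t \<le> a + b * integral {0..t} u"
    and t: "t \<in> {0..T}"
  shows "u t \<le> a * exp (b * t)"
proof -
  define G where "G s = exp (- (b * s)) * (a + b * integral {0..s} u)" for s
  define G' where "G' s = exp (- (b * s)) * (- b) * (a + b * integral {0..s} u) + exp (- (b * s)) * (b * u s)" for s
  have der: "(G has_real_derivative G' s) (at s within {0..t})" if "s \<in> {0..t}" for s
  proof -
    have "((\<lambda>x. integral {0..x} u) has_real_derivative u s) (at s within {0..t})"
      using that t by (intro integral_has_real_derivative continuous_on_subset[OF cont]) auto
    note [derivative_intros] = this
    show ?thesis unfolding G_def G'_def
      by (rule derivative_eq_intros refl | simp add: algebra_simps)+
  qed
  have nonpos: "G' s \<le> 0" if "s \<in> {0..t}" for s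
  proof -
    have "u s \<le> a + b * integral {0..s} u" using that t by (intro le) auto
    then have "exp (- (b * s)) * b * (u s - (a + b * integral {0..s} u)) \<le> 0"
      using b by (intro mult_nonneg_nonpos) auto
    then show ?thesis by (simp add: G'_def algebra_simps)
  qed
  have "G t \<le> G 0"
  \<comment> \<open>The open version asks for two-sided derivatives at interior points only, and for
    mere continuity at the ends.\<close>
  proof (rule DERIV_nonpos_imp_decreasing_open[where f = G])
    show "continuous_on {0..t} G" using der by (rule DERIV_continuous_on)
    show "\<exists>y. (G has_real_derivative y) (at x) \<and> y \<le> 0" if "0 < x" "x < t" for x
      using der[of x] nonpos[of x] that by (auto simp: at_within_Icc_at)
  qed (use t in auto)
  then have "exp (- (b * t)) * (a + b * integral {0..t} u) \<le> a" by (simp add: G_def)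
  then have "a + b * integral {0..t} u \<le> a * exp (b * t)"
    by (simp add: exp_minus field_simps)
  with le[OF t] show ?thesis by linarith
qed

text \<open>Induction with \<open>1 + c <= exp c\<close>. Each forcing term is amplified by at most
  the full factor \<open>exp (c * real n)\<close>.\<close>

lemma gronwall_discrete:
  fixes D b :: "nat \<Rightarrow> real"
  assumes c: "0 \<le> c" and b: "\<And>j. j < n \<Longrightarrow> 0 \<le> b j"
    and step: "\<And>j. j < n \<Longrightarrow> D (Suc j) \<le> (1 + c) * D j + b j"
    and D0: "0 \<le> D 0"
  shows "D n \<le> exp (c * real n) * (D 0 + (\<Sum>j<n. b j))"
  using b step
proof (induction n)
  case (Suc n)
  let ?B = "D 0 + (\<Sum>j<n. b j)"
  have B: "0 \<le> ?B" using D0 Suc.prems(1) by (intro add_nonneg_nonneg sum_nonneg) auto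
  have "D (Suc n) \<le> (1 + c) * D n + b n" using Suc.prems(2) by simp
  also have "\<dots> \<le> exp c * (exp (c * real n) * ?B) + exp (c * real (Suc n)) * b n"
  proof (rule add_mono)
    have "D n \<le> exp (c * real n) * ?B" using Suc by auto
    then have "(1 + c) * D n \<le> (1 + c) * (exp (c * real n) * ?B)"
      using c by (intro mult_left_mono) auto
    also have "\<dots> \<le> exp c * (exp (c * real n) * ?B)"
      using B exp_ge_add_one_self[of c] by (intro mult_right_mono) auto
    finally show "(1 + c) * D n \<le> exp c * (exp (c * real n) * ?B)" .
    have "1 \<le> exp (c * real (Suc n))" using c by simp
    then show "b n \<le> exp (c * real (Suc n)) * b n"
      using Suc.prems(1)[of n] mult_right_mono[of 1 "exp (c * real (Suc n))" "b n"] by simp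
  qed
  also have "\<dots> = exp (c * real (Suc n)) * (D 0 + (\<Sum>j<Suc n. b j))"
    by (simp add: algebra_simps exp_add)
  finally show ?case .
qed simp

lemma lipschitz_norm_le:
  fixes g :: "'v::real_normed_vector \<Rightarrow> 'v"
  assumes "l-lipschitz_on UNIV g"
  shows "norm (g x) \<le> norm (g 0) + l * norm x"
proof -
  have "norm (g x - g 0) \<le> l * norm (x - 0)"
    using lipschitz_onD[OF assms, of x 0] by (simp add: dist_norm)
  then show ?thesis using norm_triangle_sub[of "g x" "g 0"] by simp
qed

lemma continuous_on_lipschitz_comp:
  assumes "l-lipschitz_on UNIV g" "continuous_on A f"
  shows "continuous_on A (\<lambda>x. g (f x))"
  using continuous_on_compose2[OF lipschitz_on_continuous_on[OF assms(1)] assms(2)] by simp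

section \<open>A priori bound and local error\<close>

text \<open>Here \<open>r\<close> is the momentum without its noise, so \<open>r\<close> and
  \<open>q\<close> are differentiable in time with velocities \<open>- dV q\<close> and
  \<open>r + w\<close>. The sum of their norms then obeys a linear integral inequality whose
  inhomogeneity collects \<open>dV 0\<close> and the time integral of
  \<open>norm (w s)\<close>.\<close>

lemma hamiltonian_flow_bound:
  fixes r q w :: "real \<Rightarrow> 'v::euclidean_space"
  assumes lip: "l-lipschitz_on UNIV dV" and l: "1 \<le> l"
    and cr: "continuous_on {0..T} r" and cq: "continuous_on {0..T} q" and cw: "continuous_on {0..T} w"
    and q: "\<And>t. t \<in> {0..T} \<Longrightarrow> q t = q 0 + integral {0..t} (\<lambda>s. r s + w s)"
    and r: "\<And>t. t \<in> {0..T} \<Longrightarrow> r t = r 0 - integral {0..t} (\<lambda>s. dV (q s))"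
    and t: "t \<in> {0..T}"
  shows "norm (r t) + norm (q t) \<le>
    (norm (r 0) + norm (q 0) + T * norm (dV 0) + integral {0..T} (\<lambda>s. norm (w s))) * exp (l * T)"
    (is "_ \<le> ?a * _")
proof -
  define u where "u s = norm (r s) + norm (q s)" for s
  have cu: "continuous_on {0..T} u" unfolding u_def by (intro continuous_intros cr cq)
  have cdV: "continuous_on {0..T} (\<lambda>s. dV (q s))" by (rule continuous_on_lipschitz_comp[OF lip cq])
  have T: "0 \<le> T" using t by auto
  have a: "0 \<le> ?a" using T by (intro add_nonneg_nonneg integral_nonneg mult_nonneg_nonneg integrable_continuous_real continuous_intros cw) auto
  have "u t \<le> ?a * exp (l * t)"
  proof (rule gronwall_integral[OF cu _ _ t])
    show "0 \<le> l" using l by simp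
    fix t assume t: "t \<in> {0..T}"
    have sub: "{0..t} \<subseteq> {0..T}" using t by auto
    note cs = continuous_on_subset[OF _ sub]
    have "norm (integral {0..t} (\<lambda>s. r s + w s)) \<le> integral {0..t} (\<lambda>s. norm (r s) + norm (w s))"
      by (intro integral_norm_bound_integral integrable_continuous_real continuous_intros cs[OF cr] cs[OF cw] norm_triangle_ineq)
    moreover have "norm (integral {0..t} (\<lambda>s. dV (q s))) \<le> integral {0..t} (\<lambda>s. norm (dV 0) + l * norm (q s))"
      by (intro integral_norm_bound_integral integrable_continuous_real continuous_intros cs[OF cdV] cs[OF cq] lipschitz_norm_le[OF lip])
    ultimately have "u t \<le> norm (r 0) + norm (q 0) + (integral {0..t} (\<lambda>s. norm (r s) + norm (w s)) + integral {0..t} (\<lambda>s. norm (dV 0) + l * norm (q s)))"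
      unfolding u_def using norm_triangle_ineq[of "q 0" "integral {0..t} (\<lambda>s. r s + w s)"]
        norm_triangle_ineq4[of "r 0" "integral {0..t} (\<lambda>s. dV (q s))"] q[OF t] r[OF t] by auto
    also have "integral {0..t} (\<lambda>s. norm (r s) + norm (w s)) + integral {0..t} (\<lambda>s. norm (dV 0) + l * norm (q s))
      = integral {0..t} (\<lambda>s. norm (r s) + norm (w s) + (norm (dV 0) + l * norm (q s)))"
      by (intro integral_add[symmetric] integrable_continuous_real continuous_intros cs[OF cr] cs[OF cw] cs[OF cq])
    also have "\<dots> \<le> integral {0..t} (\<lambda>s. (norm (w s) + norm (dV 0)) + l * u s)"
    proof (intro integral_le integrable_continuous_real continuous_intros cs[OF cr] cs[OF cw] cs[OF cq] cs[OF cu])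
      fix s
      \<comment> \<open>The assumption \<open>1 <= l\<close> lets one rate serve both components:
        \<open>r\<close> enters with coefficient 1 and \<open>q\<close> with coefficient
        \<open>l\<close>.\<close>
      have "norm (r s) \<le> l * norm (r s)" using mult_right_mono[OF l norm_ge_zero[of "r s"]] by simp
      then show "norm (r s) + norm (w s) + (norm (dV 0) + l * norm (q s)) \<le> norm (w s) + norm (dV 0) + l * u s"
        by (simp add: u_def algebra_simps)
    qed
    also have "\<dots> = integral {0..t} (\<lambda>s. norm (w s)) + t * norm (dV 0) + l * integral {0..t} u"
      using t by (simp add: integral_add integrable_continuous_real continuous_intros cs[OF cw] cs[OF cu] integrable_add)
    also have "integral {0..t} (\<lambda>s. norm (w s)) \<le> integral {0..T} (\<lambda>s. norm (w s))"
      using sub by (intro integral_subset_le integrable_continuous_real continuous_intros cs[OF cw] cw) auto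
    also have "t * norm (dV 0) \<le> T * norm (dV 0)" using t by (intro mult_right_mono) auto
    finally show "u t \<le> ?a + l * integral {0..t} u" by simp
  qed
  also have "\<dots> \<le> ?a * exp (l * T)" using t l a by (intro mult_left_mono) auto
  finally show ?thesis by (simp add: u_def)
qed

text \<open>The defect \<open>S\<close> of the noise (integral of \<open>w\<close> minus its right-endpoint rule) enters the error
  of \<open>q\<close> only additively, hence it is subtracted from the error.  It must not be estimated step by
  step: only the cancellations in the sum over all steps make it of order \<open>h\<close>.\<close>

lemma drift_preserving_step_error:
  fixes r q w :: "real \<Rightarrow> 'v::euclidean_space"
  assumes lip: "l-lipschitz_on UNIV dV" and l: "1 \<le> l"
    and h: "0 < h" "h \<le> 1" "h * l \<le> 1"
    and cr: "continuous_on {t..t+h} r" and cq: "continuous_on {t..t+h} q" and cw: "continuous_on {t..t+h} w"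
    and q: "\<And>s. s \<in> {t..t+h} \<Longrightarrow> q s = q t + integral {t..s} (\<lambda>s. r s + w s)"
    and r: "\<And>s. s \<in> {t..t+h} \<Longrightarrow> r s = r t - integral {t..s} (\<lambda>s. dV (q s))"
    and m: "\<And>s. s \<in> {t..t+h} \<Longrightarrow> norm (r s) + norm (q s) \<le> m" and v: "norm (dV 0) \<le> m"
    and Idef: "I = integral {0..1} (\<lambda>s. dV (Q + (s * h) *\<^sub>R Psi))"
    and Psi: "Psi = R + w (t + h) - (h / 2) *\<^sub>R I"
    and Q': "Q' = Q + h *\<^sub>R Psi" and R': "R' = R - h *\<^sub>R I"
    and S': "S' = S + integral {t..t+h} (\<lambda>s. w s - w (t + h))"
  shows "norm (r (t + h) - R') + norm (q (t + h) - Q' - S') \<le>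
     (1 + 10 * l * h) * (norm (r t - R) + norm (q t - Q - S))
     + 10 * l * h * (norm S + integral {t..t+h} (\<lambda>s. norm (w s)) + h * (m + norm (w (t + h))))"
proof -
  define D where "D = norm (r t - R) + norm (q t - Q - S)"
  define s where "s = norm S"
  define J where "J = integral {t..t+h} (\<lambda>s. norm (w s))"
  define w' where "w' = norm (w (t + h))"
  define z where "z = norm Psi"
  have tt: "t \<in> {t..t+h}" using h by auto
  have m0: "0 \<le> m" using v norm_ge_zero order_trans by blast
  have pos: "0 \<le> D" "0 \<le> s" "0 \<le> w'" "0 \<le> z" by (auto simp: D_def s_def w'_def z_def)
  have J: "0 \<le> J" unfolding J_def
    by (intro integral_nonneg integrable_continuous_real continuous_intros cw) auto
  have mr: "norm (r s) \<le> m" and mq: "norm (q s) \<le> m" if "s \<in> {t..t+h}" for s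
    using m[OF that] norm_ge_zero[of "r s"] norm_ge_zero[of "q s"] by linarith+
  have hl: "h * l * x \<le> x" if "0 \<le> x" for x using mult_right_mono[OF h(3) that] by simp
  have hh: "h * x \<le> x" if "0 \<le> x" for x using mult_right_mono[OF h(2) that] by simp
  have ll: "x \<le> l * x" if "0 \<le> x" for x using mult_right_mono[OF l that] by simp
  have R: "norm R \<le> m + D"
    using norm_triangle_sub[of R "r t"] mr[OF tt] norm_ge_zero[of "q t - Q - S"] unfolding D_def norm_minus_commute[of R "r t"] by linarith
  have eq: "norm (q t - Q) \<le> D + s"
    using norm_triangle_ineq[of "q t - Q - S" S] norm_ge_zero[of "r t - R"] unfolding D_def s_def diff_add_cancel by linarith
  have Q: "norm Q \<le> m + D + s"
    using norm_triangle_sub[of Q "q t"] mq[OF tt] eq unfolding norm_minus_commute[of Q "q t"] by linarith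
  have cQ: "continuous_on {0..1} (\<lambda>s. dV (Q + (s * h) *\<^sub>R Psi))"
    by (intro continuous_on_lipschitz_comp[OF lip] continuous_intros)
  have hz: "norm ((x * h) *\<^sub>R Psi) \<le> h * z" if "x \<in> {0..1}" for x
    using that h pos mult_right_mono[of x 1 "h * z"] by (auto simp: z_def abs_mult mult.assoc)
  have I1: "norm I \<le> m + l * (m + D + s) + l * h * z"
  proof -
    have "norm I \<le> (m + l * (m + D + s + h * z)) * (1 - 0)" unfolding Idef
    proof (rule integral_bound[OF _ cQ])
      fix x :: real assume x: "x \<in> {0..1}"
      have "norm (Q + (x * h) *\<^sub>R Psi) \<le> m + D + s + h * z"
        using norm_triangle_ineq[of Q "(x * h) *\<^sub>R Psi"] Q hz[OF x] by linarith
      then have "l * norm (Q + (x * h) *\<^sub>R Psi) \<le> l * (m + D + s + h * z)" using l by (intro mult_left_mono) auto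
      then show "norm (dV (Q + (x * h) *\<^sub>R Psi)) \<le> m + l * (m + D + s + h * z)"
        using lipschitz_norm_le[OF lip, of "Q + (x * h) *\<^sub>R Psi"] v by linarith
    qed simp
    then show ?thesis by (simp add: algebra_simps)
  qed
  have hI: "h * norm I \<le> 2 * m + D + s + z"
  proof -
    have "h * norm I \<le> h * (m + l * (m + D + s) + l * h * z)" using h I1 by (intro mult_left_mono) auto
    also have "\<dots> = h * m + h * l * (m + D + s) + h * l * (h * z)" by (simp add: algebra_simps)
    also have "\<dots> \<le> 2 * m + D + s + z"
    proof -
      have "0 \<le> m + D + s" "0 \<le> h * z" using pos m0 h by auto
      from hl[OF this(1)] hl[OF this(2)] hh[OF m0] hh[OF pos(4)] show ?thesis by linarith
    qed
    finally show ?thesis .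
  qed
  \<comment> \<open>The scheme is implicit, so \<open>hI\<close> still contains \<open>z\<close>. It
    enters here with the factor 1/2 of the internal stage and is absorbed on the left; this is where
    the smallness \<open>h * l <= 1\<close> pays off.\<close>
  have z: "z \<le> 4 * m + 3 * D + 2 * w' + s"
  proof -
    have "z \<le> norm R + w' + norm ((h / 2) *\<^sub>R I)" unfolding z_def w'_def
      by (subst Psi) (use norm_triangle_ineq4[of "R + w (t+h)" "(h/2) *\<^sub>R I"] norm_triangle_ineq[of R "w (t+h)"] in linarith)
    also have "norm ((h / 2) *\<^sub>R I) = h * norm I / 2" using h by simp
    finally show ?thesis using R hI by linarith
  qed
  \<comment> \<open>The terms are sorted by order. The data \<open>m\<close> and \<open>w'\<close>
    must keep a factor \<open>h\<close>, since one more factor \<open>h\<close> makes their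
    contribution to the step quadratic; \<open>D\<close> and \<open>s\<close> may lose it, as the
    Gronwall argument tolerates them with a single \<open>h\<close>. The bound \<open>Iq\<close> is
    sorted in the same way.\<close>
  have I: "h / 2 * norm I \<le> l * (2 * D + s) + h * l * (3 * m + w')"
  proof -
    have "h / 2 * norm I \<le> h / 2 * (m + l * (m + D + s) + l * h * z)" using h I1 by (intro mult_left_mono) auto
    also have "\<dots> = (h * m + h * l * m + h * l * (D + s) + h * (h * l * z)) / 2" by (simp add: algebra_simps)
    also have "h * m \<le> h * l * m" using ll[OF m0] h by (simp add: mult.assoc mult_left_mono)
    also have "h * (h * l * z) \<le> h * z" using hl[OF pos(4)] h by (intro mult_left_mono) auto
    also have "h * z \<le> h * (4 * m + 3 * D + 2 * w' + s)" using z h by (intro mult_left_mono) auto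
    also have "\<dots> = h * (4 * m + 2 * w') + h * (3 * D + s)" by (simp add: algebra_simps)
    also have "h * (3 * D + s) \<le> 3 * D + s" using hh[of "3 * D + s"] pos by simp
    also have "h * l * (D + s) \<le> D + s" using hl[of "D + s"] pos by simp
    also have "h * (4 * m + 2 * w') \<le> h * l * (4 * m + 2 * w')"
      using ll[of "4 * m + 2 * w'"] m0 pos h by (simp add: mult.assoc mult_left_mono)
    finally have "h / 2 * norm I \<le> (h * l * m + h * l * m + (D + s) + (h * l * (4 * m + 2 * w') + (3 * D + s))) / 2"
      by simp
    also have "\<dots> = 2 * D + s + h * l * (3 * m + w')" by (simp add: algebra_simps)
    also have "2 * D + s \<le> l * (2 * D + s)" using ll[of "2 * D + s"] pos by simp
    finally show ?thesis by simp
  qed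
  have Iq: "norm (I - dV (q t)) \<le> l * (4 * D + 2 * s) + h * l * (4 * m + 2 * w')"
  proof -
    have "I - dV (q t) = integral {0..1} (\<lambda>s. dV (Q + (s * h) *\<^sub>R Psi) - dV (q t))"
      unfolding Idef using integral_diff[OF integrable_continuous_real[OF cQ] integrable_const_ivl[of "dV (q t)"]] by simp
    also have "norm \<dots> \<le> l * (D + s + h * z) * (1 - 0)"
    proof (rule integral_bound)
      fix x :: real assume x: "x \<in> {0..1}"
      have "norm (Q + (x * h) *\<^sub>R Psi - q t) \<le> D + s + h * z"
        using norm_triangle_ineq[of "Q - q t" "(x * h) *\<^sub>R Psi"] eq hz[OF x]
        unfolding norm_minus_commute[of Q] by (simp add: algebra_simps)
      then have "l * norm (Q + (x * h) *\<^sub>R Psi - q t) \<le> l * (D + s + h * z)" using l by (intro mult_left_mono) auto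
      then show "norm (dV (Q + (x * h) *\<^sub>R Psi) - dV (q t)) \<le> l * (D + s + h * z)"
        using lipschitz_onD[OF lip, of "Q + (x * h) *\<^sub>R Psi" "q t"] by (simp add: dist_norm)
    qed (auto intro!: continuous_intros cQ)
    also have "\<dots> = l * (D + s) + h * l * z" by (simp add: algebra_simps)
    also have "h * l * z \<le> h * l * (4 * m + 3 * D + 2 * w' + s)" using z h l by (intro mult_left_mono) auto
    also have "\<dots> = h * l * (4 * m + 2 * w') + h * l * (3 * D + s)" by (simp add: algebra_simps)
    also have "h * l * (3 * D + s) \<le> l * (3 * D + s)"
      using hh[of "l * (3 * D + s)"] pos l by (simp add: mult.assoc)
    finally show ?thesis by (simp add: algebra_simps)
  qed
  have cdV: "continuous_on {t..t+h} (\<lambda>s. dV (q s))" by (rule continuous_on_lipschitz_comp[OF lip cq])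
  \<comment> \<open>During one step \<open>q\<close> moves by at most \<open>h * m + J\<close>. The
    noise part stays an integral over the cell, so that summing over all cells gives an integral
    over the whole time interval.\<close>
  have intq: "norm (integral {t..t+h} (\<lambda>s. dV (q s)) - h *\<^sub>R dV (q t)) \<le> h * l * (h * m + J)"
  proof -
    have "integral {t..t+h} (\<lambda>s. dV (q s)) - h *\<^sub>R dV (q t) = integral {t..t+h} (\<lambda>s. dV (q s) - dV (q t))"
      using integral_diff[OF integrable_continuous_real[OF cdV] integrable_const_ivl[of "dV (q t)"]] h by simp
    also have "norm \<dots> \<le> l * (h * m + J) * (t + h - t)"
    proof (rule integral_bound)
      fix x assume x: "x \<in> {t..t+h}"
      have sub: "{t..x} \<subseteq> {t..t+h}" using x by auto
      have "norm (q x - q t) = norm (integral {t..x} (\<lambda>s. r s + w s))" using q[OF x] by simp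
      also have "\<dots> \<le> integral {t..x} (\<lambda>s. m + norm (w s))"
      proof (intro integral_norm_bound_integral integrable_continuous_real continuous_intros continuous_on_subset[OF cr sub] continuous_on_subset[OF cw sub])
        fix y assume "y \<in> {t..x}"
        then have "norm (r y) \<le> m" using sub mr by auto
        then show "norm (r y + w y) \<le> m + norm (w y)" using norm_triangle_ineq[of "r y" "w y"] by linarith
      qed
      also have "\<dots> \<le> integral {t..t+h} (\<lambda>s. m + norm (w s))"
        using sub m0 by (intro integral_subset_le integrable_continuous_real continuous_intros continuous_on_subset[OF cw sub] cw) auto
      also have "\<dots> = h * m + J"
        using h by (simp add: J_def integral_add integrable_continuous_real continuous_intros cw)
      finally have "l * norm (q x - q t) \<le> l * (h * m + J)" using l by (intro mult_left_mono) auto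
      then show "norm (dV (q x) - dV (q t)) \<le> l * (h * m + J)"
        using lipschitz_onD[OF lip, of "q x" "q t"] by (simp add: dist_norm)
    qed (use h in \<open>auto intro!: continuous_intros cdV\<close>)
    finally show ?thesis by (simp add: algebra_simps)
  qed
  \<comment> \<open>In time, \<open>r\<close> is Lipschitz with constant
    \<open>2 * l * m\<close>.\<close>
  have intr: "norm (integral {t..t+h} (\<lambda>s. r s - R)) \<le> h * (norm (r t - R) + 2 * h * l * m)"
  proof -
    have "norm (integral {t..t+h} (\<lambda>s. r s - R)) \<le> (norm (r t - R) + 2 * h * l * m) * (t + h - t)"
    proof (rule integral_bound)
      fix x assume x: "x \<in> {t..t+h}"
      have sub: "{t..x} \<subseteq> {t..t+h}" using x by auto
      have "norm (r x - r t) = norm (integral {t..x} (\<lambda>s. dV (q s)))" using r[OF x] by simp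
      also have "\<dots> \<le> 2 * l * m * (x - t)"
      proof (rule integral_bound[OF _ continuous_on_subset[OF cdV sub]])
        fix y assume "y \<in> {t..x}"
        then have "l * norm (q y) \<le> l * m" using sub mq l by (intro mult_left_mono) auto
        then show "norm (dV (q y)) \<le> 2 * l * m"
          using lipschitz_norm_le[OF lip, of "q y"] v ll[OF m0] by linarith
      qed (use x in auto)
      also have "\<dots> \<le> 2 * l * m * h" using x l m0 by (intro mult_left_mono) auto
      finally show "norm (r x - R) \<le> norm (r t - R) + 2 * h * l * m"
        using norm_triangle_ineq[of "r x - r t" "r t - R"] by (simp add: algebra_simps)
    qed (use h in \<open>auto intro!: continuous_intros cr\<close>)
    then show ?thesis by (simp add: algebra_simps)
  qed
  have th: "t + h \<in> {t..t+h}" using h by auto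
  have "r (t + h) - R' = (r t - R) - (integral {t..t+h} (\<lambda>s. dV (q s)) - h *\<^sub>R dV (q t)) + h *\<^sub>R (I - dV (q t))"
    unfolding R' r[OF th] by (simp add: algebra_simps)
  then have "norm (r (t + h) - R') \<le> norm (r t - R) + norm (integral {t..t+h} (\<lambda>s. dV (q s)) - h *\<^sub>R dV (q t)) + h * norm (I - dV (q t))"
    using norm_triangle_ineq[of "(r t - R) - (integral {t..t+h} (\<lambda>s. dV (q s)) - h *\<^sub>R dV (q t))" "h *\<^sub>R (I - dV (q t))"]
      norm_triangle_ineq4[of "r t - R" "integral {t..t+h} (\<lambda>s. dV (q s)) - h *\<^sub>R dV (q t)"] h by simp
  also have "h * norm (I - dV (q t)) \<le> h * (l * (4 * D + 2 * s) + h * l * (4 * m + 2 * w'))"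
    using Iq h by (intro mult_left_mono) auto
  finally have 1: "norm (r (t + h) - R') \<le> norm (r t - R) + h * l * (h * m + J) + h * (l * (4 * D + 2 * s) + h * l * (4 * m + 2 * w'))"
    using intq by linarith
  \<comment> \<open>The noise in the exact position step is split into its right-endpoint value,
    which cancels against the one in \<open>Psi\<close>, and the defect, which is the increment
    \<open>S' - S\<close>. Besides the drift difference only the term \<open>h * (h / 2) * I\<close>
    is left.\<close>
  have "integral {t..t+h} (\<lambda>s. r s + w s) = integral {t..t+h} (\<lambda>s. r s - R) + h *\<^sub>R R + (integral {t..t+h} (\<lambda>s. w s - w (t + h)) + h *\<^sub>R w (t + h))"
    using h by (simp add: integral_add integral_diff integrable_continuous_real cr cw)
  then have "q (t + h) - Q' - S' = (q t - Q - S) + integral {t..t+h} (\<lambda>s. r s - R) + h *\<^sub>R ((h / 2) *\<^sub>R I)"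
    unfolding Q' S' q[OF th] by (subst Psi) (simp add: algebra_simps)
  then have "norm (q (t + h) - Q' - S') \<le> norm (q t - Q - S) + norm (integral {t..t+h} (\<lambda>s. r s - R)) + h * (h / 2 * norm I)"
    using norm_triangle_ineq[of "(q t - Q - S) + integral {t..t+h} (\<lambda>s. r s - R)" "h *\<^sub>R ((h / 2) *\<^sub>R I)"]
      norm_triangle_ineq[of "q t - Q - S" "integral {t..t+h} (\<lambda>s. r s - R)"] h by simp
  also have "h * (h / 2 * norm I) \<le> h * (l * (2 * D + s) + h * l * (3 * m + w'))"
    using I h by (intro mult_left_mono) auto
  finally have 2: "norm (q (t + h) - Q' - S') \<le> norm (q t - Q - S) + h * (norm (r t - R) + 2 * h * l * m) + h * (l * (2 * D + s) + h * l * (3 * m + w'))"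
    using intr by linarith
  have "norm (r t - R) \<le> D" by (simp add: D_def)
  then have "norm (r t - R) \<le> l * D" using ll[OF pos(1)] by linarith
  then have 3: "h * norm (r t - R) \<le> h * (l * D)" using h by (intro mult_left_mono) auto
  have "norm (r (t + h) - R') + norm (q (t + h) - Q' - S') \<le> D + h * l * (7 * D + 3 * s + J + h * (10 * m + 3 * w'))"
    using 1 2 3 unfolding D_def by (simp add: algebra_simps)
  \<comment> \<open>All coefficients are rounded up to 10 to obtain one common constant.\<close>
  also have "h * l * (7 * D + 3 * s + J + h * (10 * m + 3 * w')) \<le> h * l * (10 * D + 10 * s + 10 * J + h * (10 * m + 10 * w'))"
    using h l pos J m0 by (intro mult_left_mono add_mono) auto
  finally show ?thesis
    unfolding D_def[symmetric] s_def[symmetric] J_def[symmetric] w'_def[symmetric] by (simp add: algebra_simps)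
qed

section \<open>Accumulation of the errors over the grid\<close>

lemma integral_grid_sum:
  fixes g :: "real \<Rightarrow> 'v::euclidean_space"
  assumes "0 \<le> h" "continuous_on {0..real n * h} g"
  shows "(\<Sum>j<n. integral {real j * h..real j * h + h} g) = integral {0..real n * h} g"
  using assms(2)
proof (induction n)
  case (Suc n)
  have "{0..real n * h} \<subseteq> {0..real (Suc n) * h}" using assms(1) by (auto simp: algebra_simps)
  then have "(\<Sum>j<n. integral {real j * h..real j * h + h} g) = integral {0..real n * h} g"
    using Suc by (meson continuous_on_subset)
  moreover have "integral {0..real n * h} g + integral {real n * h..real (Suc n) * h} g = integral {0..real (Suc n) * h} g"
    using assms(1) Suc.prems by (intro Henstock_Kurzweil_Integration.integral_combine integrable_continuous_real) (auto simp: algebra_simps)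
  moreover have "real n * h + h = real (Suc n) * h" by (simp add: algebra_simps)
  ultimately show ?case by simp
qed simp

text \<open>Shifting all cells to \<open>{0..h}\<close> aligns the increments with the same offset
  \<open>u\<close>. The sum goes inside the integral before the norm is taken, so the cancellations
  between cells survive.\<close>

lemma grid_noise_defect_le:
  fixes w :: "real \<Rightarrow> 'v::euclidean_space"
  assumes h: "0 \<le> h" and cw: "continuous_on {0..real n * h} w"
  shows "norm (\<Sum>j<n. integral {real j * h..real j * h + h} (\<lambda>s. w s - w (real j * h + h)))
    \<le> integral {0..h} (\<lambda>u. norm (\<Sum>j<n. w (real j * h + u) - w (real j * h + h)))"
proof -
  have c: "continuous_on {0..h} (\<lambda>u. w (real j * h + u))" if "j < n" for j
  proof (rule continuous_on_compose2[OF cw])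
    have "(real j + 1) * h \<le> real n * h" using that h by (intro mult_right_mono) auto
    then show "(\<lambda>u. real j * h + u) ` {0..h} \<subseteq> {0..real n * h}" using h by (auto simp: algebra_simps)
  qed (intro continuous_intros)
  have "integral {real j * h..real j * h + h} (\<lambda>s. w s - w (real j * h + h))
     = integral {0..h} (\<lambda>u. w (real j * h + u) - w (real j * h + h))" for j
    using has_integral_shift_Icc_real[of "\<lambda>s. w s - w (real j * h + h)" "real j * h" _ 0 h]
    by (simp add: o_def integral_def integrable_on_def add.commute)
  then have "(\<Sum>j<n. integral {real j * h..real j * h + h} (\<lambda>s. w s - w (real j * h + h)))
    = (\<Sum>j<n. integral {0..h} (\<lambda>u. w (real j * h + u) - w (real j * h + h)))" by simp
  also have "\<dots> = integral {0..h} (\<lambda>u. \<Sum>j<n. w (real j * h + u) - w (real j * h + h))"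
    by (intro integral_sum[symmetric] integrable_continuous_real continuous_intros c) auto
  also have "norm \<dots> \<le> integral {0..h} (\<lambda>u. norm (\<Sum>j<n. w (real j * h + u) - w (real j * h + h)))"
    by (intro integral_norm_bound_integral integrable_continuous_real continuous_intros c) auto
  finally show ?thesis .
qed

text \<open>Discrete Gronwall with rate \<open>10 * l * h\<close> over \<open>n\<close> steps costs
  only \<open>exp (10 * l * T)\<close>. The sum of the \<open>norm (S j)\<close> is harmless because
  every \<open>S j\<close> will be of order \<open>h\<close> in the mean, which compensates for the
  number of steps; the prefactor \<open>h\<close> then gives order 1.\<close>

lemma drift_preserving_global_error:
  fixes p q w :: "real \<Rightarrow> 'v::euclidean_space" and P Q Psi S :: "nat \<Rightarrow> 'v"
  assumes lip: "l-lipschitz_on UNIV dV" and l: "1 \<le> l"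
    and h: "0 < h" "h \<le> 1" "h * l \<le> 1" and N: "h * real N = T"
    and cp: "continuous_on {0..T} p" and cq: "continuous_on {0..T} q" and cw: "continuous_on {0..T} w"
    and w0: "w 0 = 0"
    and q: "\<And>t. t \<in> {0..T} \<Longrightarrow> q t = q 0 + integral {0..t} p"
    and p: "\<And>t. t \<in> {0..T} \<Longrightarrow> p t = p 0 - integral {0..t} (\<lambda>s. dV (q s)) + w t"
    and P0: "P 0 = p 0" and Q0: "Q 0 = q 0"
    and Idef: "\<And>j. j < N \<Longrightarrow> I j = integral {0..1} (\<lambda>s. dV (Q j + (s * h) *\<^sub>R Psi (Suc j)))"
    and Psi: "\<And>j. j < N \<Longrightarrow> Psi (Suc j) = P j + (w (real (Suc j) * h) - w (real j * h)) - (h / 2) *\<^sub>R I j"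
    and QS: "\<And>j. j < N \<Longrightarrow> Q (Suc j) = Q j + h *\<^sub>R Psi (Suc j)"
    and PS: "\<And>j. j < N \<Longrightarrow> P (Suc j) = P j + (w (real (Suc j) * h) - w (real j * h)) - h *\<^sub>R I j"
    and S: "\<And>j. S j = (\<Sum>i<j. integral {real i * h..real i * h + h} (\<lambda>s. w s - w (real i * h + h)))"
    and m: "\<And>t. t \<in> {0..T} \<Longrightarrow> norm (p t - w t) + norm (q t) \<le> m" and v: "norm (dV 0) \<le> m"
    and n: "n \<le> N"
  shows "norm (p (real n * h) - P n) + norm (q (real n * h) - Q n - S n) \<le>
     10 * l * exp (10 * l * T) * h * ((\<Sum>j<n. norm (S j)) + integral {0..T} (\<lambda>s. norm (w s)) + T * m
        + h * (\<Sum>j<n. norm (w (real j * h + h))))"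
proof -
  define r where "r t = p t - w t" for t
  define D where "D j = norm (r (real j * h) - (P j - w (real j * h))) + norm (q (real j * h) - Q j - S j)" for j
  define b where "b j = 10 * l * h * (norm (S j) + integral {real j * h..real j * h + h} (\<lambda>s. norm (w s)) + h * (m + norm (w (real j * h + h))))" for j
  have m0: "0 \<le> m" using v norm_ge_zero order_trans by blast
  have cr: "continuous_on {0..T} r" unfolding r_def by (intro continuous_intros cp cw)
  have cdV: "continuous_on {0..T} (\<lambda>s. dV (q s))" by (rule continuous_on_lipschitz_comp[OF lip cq])
  have inT: "{real j * h..real j * h + h} \<subseteq> {0..T}" if "j < N" for j
  proof -
    have "(real j + 1) * h \<le> real N * h" using that h by (intro mult_right_mono) auto
    then show ?thesis using h N by (auto simp: algebra_simps)
  qed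
  have diff: "integral {0..t} g = integral {0..s} g + integral {s..t} g"
    if "0 \<le> s" "s \<le> t" "t \<le> T" "continuous_on {0..T} g" for s t and g :: "real \<Rightarrow> 'v"
  proof -
    have "g integrable_on {0..t}"
      using that by (intro integrable_continuous_real continuous_on_subset[OF that(4)]) auto
    then show ?thesis using Henstock_Kurzweil_Integration.integral_combine[OF that(1,2), of g] by simp
  qed
  have step: "D (Suc j) \<le> (1 + 10 * l * h) * D j + b j" and bj: "0 \<le> b j" if "j < n" for j
  proof -
    have jN: "j < N" using that n by simp
    let ?t = "real j * h"
    have t0: "0 \<le> ?t" using h by simp
    have t1: "?t + h \<le> T" using inT[OF jN] h by auto
    have tS: "real (Suc j) * h = ?t + h" by (simp add: algebra_simps)
    have mem: "s \<in> {0..T}" if "s \<in> {?t..?t+h}" for s using inT[OF jN] that by blast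
    have tm: "?t \<in> {0..T}" using t0 t1 h by auto
    have "integral {?t..?t+h} (\<lambda>s. norm (w s)) \<ge> 0"
      by (intro integral_nonneg integrable_continuous_real continuous_intros continuous_on_subset[OF cw inT[OF jN]]) auto
    then show "0 \<le> b j" unfolding b_def using l h m0 by (intro mult_nonneg_nonneg add_nonneg_nonneg) auto
    have "norm (r (?t + h) - (P (Suc j) - w (?t + h))) + norm (q (?t + h) - Q (Suc j) - S (Suc j)) \<le>
     (1 + 10 * l * h) * (norm (r ?t - (P j - w ?t)) + norm (q ?t - Q j - S j))
     + 10 * l * h * (norm (S j) + integral {?t..?t+h} (\<lambda>s. norm (w s)) + h * (m + norm (w (?t + h))))"
    \<comment> \<open>The numerical momentum is also freed of its noise: \<open>R\<close> is
      \<open>P j - w ?t\<close>. Then the increment in the scheme becomes the single right-endpoint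
      value \<open>w (?t + h)\<close>.\<close>
    proof (rule drift_preserving_step_error[OF lip l h])
      show "continuous_on {?t..?t+h} r" "continuous_on {?t..?t+h} q" "continuous_on {?t..?t+h} w"
        by (rule continuous_on_subset[OF _ inT[OF jN]], fact)+
      show "q s = q ?t + integral {?t..s} (\<lambda>s. r s + w s)" if s: "s \<in> {?t..?t+h}" for s
        using q[OF mem[OF s]] q[OF tm] diff[of ?t s p] s t0 mem[OF s] cp by (simp add: r_def)
      show "r s = r ?t - integral {?t..s} (\<lambda>s. dV (q s))" if s: "s \<in> {?t..?t+h}" for s
        using p[OF mem[OF s]] p[OF tm] diff[of ?t s "\<lambda>s. dV (q s)"] s t0 mem[OF s] cdV by (simp add: r_def)
      show "norm (r s) + norm (q s) \<le> m" if s: "s \<in> {?t..?t+h}" for s using m[OF mem[OF s]] by (simp add: r_def)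
      show "I j = integral {0..1} (\<lambda>s. dV (Q j + (s * h) *\<^sub>R Psi (Suc j)))" by (rule Idef[OF jN])
      show "Psi (Suc j) = P j - w ?t + w (?t + h) - (h / 2) *\<^sub>R I j" using Psi[OF jN] unfolding tS by (simp add: algebra_simps)
      show "P (Suc j) - w (?t + h) = P j - w ?t - h *\<^sub>R I j" using PS[OF jN] unfolding tS by (simp add: algebra_simps)
      show "S (Suc j) = S j + integral {?t..?t+h} (\<lambda>s. w s - w (?t + h))" by (simp add: S)
    qed (fact v QS[OF jN])+
    then show "D (Suc j) \<le> (1 + 10 * l * h) * D j + b j" unfolding D_def b_def tS .
  qed
  have D0: "D 0 = 0" by (simp add: D_def r_def P0 Q0 S)
  have nT: "real n * h \<le> T" using n h N by (simp add: mult.commute[of h] flip: N)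
  have T: "0 \<le> T" using N h by auto
  have cn: "continuous_on {0..real n * h} (\<lambda>s. norm (w s))"
    using nT by (intro continuous_intros continuous_on_subset[OF cw]) auto
  have "D n \<le> exp (10 * l * h * real n) * (\<Sum>j<n. b j)"
    using gronwall_discrete[of "10 * l * h" n b D] step bj D0 l h by simp
  also have "\<dots> \<le> exp (10 * l * T) * (\<Sum>j<n. b j)"
    using nT l bj by (intro mult_right_mono sum_nonneg) (auto simp: mult.assoc mult.commute[of h])
  also have "(\<Sum>j<n. b j) = 10 * l * h * ((\<Sum>j<n. norm (S j)) + (\<Sum>j<n. integral {real j * h..real j * h + h} (\<lambda>s. norm (w s)))
     + (real n * h) * m + h * (\<Sum>j<n. norm (w (real j * h + h))))"
    unfolding b_def sum_distrib_left[symmetric] by (simp add: sum.distrib sum_distrib_left algebra_simps)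
  also have "\<dots> \<le> 10 * l * h * ((\<Sum>j<n. norm (S j)) + integral {0..T} (\<lambda>s. norm (w s))
     + T * m + h * (\<Sum>j<n. norm (w (real j * h + h))))"
  \<comment> \<open>The cell integrals of \<open>norm (w s)\<close> reassemble to one integral, so
    this part of the forcing does not grow with the number of steps.\<close>
  proof -
    have "(\<Sum>j<n. integral {real j * h..real j * h + h} (\<lambda>s. norm (w s))) = integral {0..real n * h} (\<lambda>s. norm (w s))"
      using h cn by (intro integral_grid_sum) auto
    also have "\<dots> \<le> integral {0..T} (\<lambda>s. norm (w s))"
      using nT by (intro integral_subset_le integrable_continuous_real cn continuous_intros cw) auto
    finally show ?thesis using nT m0 l h by (intro mult_left_mono add_mono mult_right_mono) auto
  qed
  finally have "D n \<le> exp (10 * l * T) * (10 * l * h * ((\<Sum>j<n. norm (S j)) + integral {0..T} (\<lambda>s. norm (w s))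
     + T * m + h * (\<Sum>j<n. norm (w (real j * h + h)))))" by simp
  then show ?thesis unfolding D_def r_def by (simp add: algebra_simps)
qed

text \<open>Pathwise, the noise \<open>w t = \<Sigma> (W t - W 0)\<close> is just a continuous perturbation.\<close>

definition perturbed_solution ::
  "real \<Rightarrow> ('v::euclidean_space \<Rightarrow> 'v) \<Rightarrow> (real \<Rightarrow> 'v) \<Rightarrow> (real \<Rightarrow> 'v) \<Rightarrow> (real \<Rightarrow> 'v) \<Rightarrow> bool" where
  "perturbed_solution T dV w p q \<longleftrightarrow>
     continuous_on {0..T} p \<and> continuous_on {0..T} q \<and> continuous_on {0..T} w \<and> w 0 = 0 \<and>
     (\<forall>t\<in>{0..T}. q t = q 0 + integral {0..t} p \<and>
        p t = p 0 - integral {0..t} (\<lambda>s. dV (q s)) + w t)"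

definition perturbed_scheme ::
  "('v::euclidean_space \<Rightarrow> 'v) \<Rightarrow> (real \<Rightarrow> 'v) \<Rightarrow> real \<Rightarrow> nat \<Rightarrow> (nat \<Rightarrow> 'v) \<Rightarrow> (nat \<Rightarrow> 'v) \<Rightarrow> (nat \<Rightarrow> 'v) \<Rightarrow> bool" where
  "perturbed_scheme dV w h N Psi P Q \<longleftrightarrow>
     (\<forall>j<N. let \<Delta> = w (real (Suc j) * h) - w (real j * h);
                I = integral {0..1} (\<lambda>s. dV (Q j + (s * h) *\<^sub>R Psi (Suc j)))
       in Psi (Suc j) = P j + \<Delta> - (h / 2) *\<^sub>R I \<and>
          Q (Suc j) = Q j + h *\<^sub>R Psi (Suc j) \<and>
          P (Suc j) = P j + \<Delta> - h *\<^sub>R I)"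

text \<open>The division by \<open>h\<close> normalises the defect to size 1. The norm stands inside
  the integral because for fixed \<open>u\<close> the sum is Gaussian when \<open>w\<close> is
  Brownian.\<close>

definition mean_defect :: "(real \<Rightarrow> 'v::euclidean_space) \<Rightarrow> real \<Rightarrow> nat \<Rightarrow> real" where
  "mean_defect w h n = integral {0..h} (\<lambda>u. norm (\<Sum>i<n. w (real i * h + u) - w (real i * h + h))) / h"

text \<open>One scalar that controls all noise terms of the estimates. The value at time
  \<open>n * h\<close> is for the size of the momentum, and the final summand is for the defect
  \<open>S n\<close> that has to be added back to the position error.\<close>

definition noise_size :: "(real \<Rightarrow> 'v::euclidean_space) \<Rightarrow> real \<Rightarrow> nat \<Rightarrow> nat \<Rightarrow> real" where
  "noise_size w h N n = norm (w (real n * h)) + integral {0..h * real N} (\<lambda>s. norm (w s))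
     + h * (\<Sum>j<N. norm (w (real j * h + h))) + h * (\<Sum>j<N. mean_defect w h j) + mean_defect w h n"

lemma mean_defect_nonneg:
  assumes h: "0 < h" and cw: "continuous_on {0..real n * h} w"
  shows "0 \<le> mean_defect w h n"
proof -
  have "0 \<le> integral {0..h} (\<lambda>u. norm (\<Sum>i<n. w (real i * h + u) - w (real i * h + h)))"
    using h by (intro order_trans[OF norm_ge_zero grid_noise_defect_le] cw) simp
  then show ?thesis using h by (simp add: mean_defect_def)
qed

lemma noise_size_nonneg:
  assumes h: "0 < h" and n: "n \<le> N" and cw: "continuous_on {0..h * real N} w"
  shows "0 \<le> noise_size w h N n"
proof -
  have md: "0 \<le> mean_defect w h j" if "j \<le> N" for j
  proof (rule mean_defect_nonneg[OF h continuous_on_subset[OF cw]])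
    have "real j * h \<le> real N * h" using that h by (intro mult_right_mono) auto
    then show "{0..real j * h} \<subseteq> {0..h * real N}" by (auto simp: mult.commute)
  qed
  have "0 \<le> integral {0..h * real N} (\<lambda>s. norm (w s))"
    by (intro integral_nonneg integrable_continuous_real continuous_intros cw) auto
  then show ?thesis unfolding noise_size_def using md h n
    by (intro add_nonneg_nonneg mult_nonneg_nonneg sum_nonneg) auto
qed

text \<open>The constant is chosen before \<open>h\<close>, \<open>N\<close> and the noise path, so
  that the estimate can be applied for each \<open>\<omega>\<close> separately with one
  \<open>C\<close>. The same random quantity bounds the exact state and, with an extra
  \<open>h\<close>, the error.\<close>

lemma drift_preserving_pathwise:
  fixes dV :: "'v::euclidean_space \<Rightarrow> 'v"
  assumes lip: "l-lipschitz_on UNIV dV" and l: "1 \<le> l" and T: "0 < T"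
  obtains C where "0 < C"
    "\<And>h N n p q w P Q Psi. \<lbrakk>0 < h; h \<le> 1; h * l \<le> 1; h * real N = T; n \<le> N;
      perturbed_solution T dV w p q; perturbed_scheme dV w h N Psi P Q; P 0 = p 0; Q 0 = q 0\<rbrakk>
     \<Longrightarrow> norm (p (real n * h), q (real n * h)) \<le> C * (1 + norm (p 0) + norm (q 0) + noise_size w h N n) \<and>
         norm ((p (real n * h), q (real n * h)) - (P n, Q n)) \<le> C * h * (1 + norm (p 0) + norm (q 0) + noise_size w h N n)"
proof -
  define v where "v = norm (dV 0)"
  \<comment> \<open>\<open>C1 * Z\<close> will be the bound \<open>m\<close> of the local analysis,
    which has to dominate both the flow and \<open>norm (dV 0)\<close>; the latter explains the
    summand \<open>v\<close>. In \<open>C2\<close> the summand 1 pays for adding \<open>S n\<close>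
    back.\<close>
  define C1 where "C1 = exp (l * T) * (1 + T * v) + v"
  define C2 where "C2 = 10 * l * exp (10 * l * T) * (1 + T * C1) + 1"
  have v: "0 \<le> v" by (simp add: v_def)
  have C1: "0 < C1" unfolding C1_def using v T by (intro add_pos_nonneg mult_pos_pos) (auto intro: add_pos_nonneg)
  have C2: "0 < C2" unfolding C2_def using l T C1 by (intro add_nonneg_pos mult_nonneg_nonneg) auto
  show ?thesis
  proof (rule that[of "C1 + 1 + C2"], goal_cases)
    case 1 then show ?case using C1 C2 by simp
  next
    case hyps: (2 h N n p q w P Q Psi)
    define Z where "Z = 1 + norm (p 0) + norm (q 0) + noise_size w h N n"
    define I where "I j = integral {0..1} (\<lambda>s. dV (Q j + (s * h) *\<^sub>R Psi (Suc j)))" for j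
    note h = hyps(1-3) and N = hyps(4) and n = hyps(5)
    have cp: "continuous_on {0..T} p" and cq: "continuous_on {0..T} q" and cw: "continuous_on {0..T} w" and w0: "w 0 = 0"
      and q: "\<And>t. t \<in> {0..T} \<Longrightarrow> q t = q 0 + integral {0..t} p"
      and p: "\<And>t. t \<in> {0..T} \<Longrightarrow> p t = p 0 - integral {0..t} (\<lambda>s. dV (q s)) + w t"
      using hyps(6)[unfolded perturbed_solution_def] by blast+
    note sch = hyps(7)[unfolded perturbed_scheme_def Let_def, folded I_def, rule_format]
    note scheme = conjunct1[OF sch] conjunct1[OF conjunct2[OF sch]] conjunct2[OF conjunct2[OF sch]]
    define S where "S j = (\<Sum>i<j. integral {real i * h..real i * h + h} (\<lambda>s. w s - w (real i * h + h)))" for j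
    define g where "g j = integral {0..h} (\<lambda>u. norm (\<Sum>i<j. w (real i * h + u) - w (real i * h + h)))" for j
    define J where "J = integral {0..T} (\<lambda>s. norm (w s))"
    define E where "E = h * (\<Sum>j<N. norm (w (real j * h + h)))"
    have sub: "{0..real j * h} \<subseteq> {0..T}" if "j \<le> N" for j
    proof -
      have "real j * h \<le> real N * h" using that h(1) by (intro mult_right_mono) auto
      then show ?thesis using N by (auto simp: mult.commute)
    qed
    have Sg: "norm (S j) \<le> g j" if "j \<le> N" for j
      unfolding S_def g_def using h(1) by (intro grid_noise_defect_le continuous_on_subset[OF cw sub[OF that]]) auto
    have g0: "0 \<le> g j" if "j \<le> N" for j using Sg[OF that] norm_ge_zero order_trans by blast
    have J0: "0 \<le> J" unfolding J_def by (intro integral_nonneg integrable_continuous_real continuous_intros cw) auto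
    have E0: "0 \<le> E" unfolding E_def using h(1) by (intro mult_nonneg_nonneg sum_nonneg) auto
    have G0: "0 \<le> (\<Sum>j<N. g j)" using g0 by (intro sum_nonneg) auto
    have gn0: "0 \<le> g n / h" using g0[OF n] h(1) by simp
    have md: "mean_defect w h j = g j / h" for j by (simp add: mean_defect_def g_def)
    \<comment> \<open>The weight \<open>h\<close> in \<open>noise_size\<close> undoes the
      normalisation of \<open>mean_defect\<close>, so \<open>Z\<close> dominates the plain sum of
      the defects \<open>g j\<close>.\<close>
    have "h * (\<Sum>j<N. g j / h) = (\<Sum>j<N. g j)" using h by (simp add: sum_distrib_left)
    then have Z: "Z = 1 + norm (p 0) + norm (q 0) + norm (w (real n * h)) + J + E + (\<Sum>j<N. g j) + g n / h"
      unfolding Z_def noise_size_def md N J_def E_def by simp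
    have Z1: "1 \<le> Z" and parts: "norm (p 0) + norm (q 0) + J \<le> Z" "norm (w (real n * h)) \<le> Z"
      "(\<Sum>j<N. g j) + J + E \<le> Z" "g n / h \<le> Z"
      using J0 E0 G0 gn0 unfolding Z by (simp_all add: add_increasing)
    have nT: "real n * h \<in> {0..T}" using sub[OF n] h(1) by auto
    have bound: "norm (p t - w t) + norm (q t) \<le> exp (l * T) * (1 + T * v) * Z" if t: "t \<in> {0..T}" for t
    proof -
      have "norm (p t - w t) + norm (q t) \<le> (norm (p 0 - w 0) + norm (q 0) + T * norm (dV 0) + integral {0..T} (\<lambda>s. norm (w s))) * exp (l * T)"
      proof (rule hamiltonian_flow_bound[OF lip l _ cq cw _ _ t, where r = "\<lambda>t. p t - w t"])
        show "continuous_on {0..T} (\<lambda>t. p t - w t)" by (intro continuous_intros cp cw)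
        show "q t = q 0 + integral {0..t} (\<lambda>s. p s - w s + w s)" if "t \<in> {0..T}" for t
          unfolding diff_add_cancel by (rule q[OF that])
        show "p t - w t = p 0 - w 0 - integral {0..t} (\<lambda>s. dV (q s))" if "t \<in> {0..T}" for t
          by (subst p[OF that]) (simp add: w0)
      qed
      also have "\<dots> = (norm (p 0) + norm (q 0) + J + T * v) * exp (l * T)" by (simp add: w0 J_def v_def)
      also have "\<dots> \<le> (Z + T * v * Z) * exp (l * T)"
        using parts(1) Z1 T v mult_left_mono[of 1 Z "T * v"] by (intro mult_right_mono add_mono) auto
      finally show ?thesis by (simp add: algebra_simps)
    qed
    have C1Z: "exp (l * T) * (1 + T * v) * Z + v * Z = C1 * Z" by (simp add: C1_def algebra_simps)
    have vZ: "v \<le> v * Z" using v Z1 mult_left_mono[of 1 Z v] by simp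
    have nonneg: "0 \<le> exp (l * T) * (1 + T * v) * Z" using T v Z1 by (intro mult_nonneg_nonneg) auto
    have "norm (p (real n * h) - P n) + norm (q (real n * h) - Q n - S n) \<le>
      10 * l * exp (10 * l * T) * h * ((\<Sum>j<n. norm (S j)) + integral {0..T} (\<lambda>s. norm (w s)) + T * (C1 * Z)
        + h * (\<Sum>j<n. norm (w (real j * h + h))))"
    proof (rule drift_preserving_global_error[OF lip l h N cp cq cw w0 q p hyps(8,9) I_def scheme S_def _ _ n])
      show "norm (p t - w t) + norm (q t) \<le> C1 * Z" if "t \<in> {0..T}" for t
        using bound[OF that] v vZ unfolding C1Z[symmetric] by linarith
      show "norm (dV 0) \<le> C1 * Z" unfolding C1Z[symmetric] using vZ nonneg by (simp add: v_def)
    qed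
    also have "\<dots> \<le> 10 * l * exp (10 * l * T) * h * (Z + T * (C1 * Z))"
    proof (rule mult_left_mono)
      have "(\<Sum>j<n. norm (S j)) \<le> (\<Sum>j<n. g j)" using Sg n by (intro sum_mono) auto
      also have "\<dots> \<le> (\<Sum>j<N. g j)" using n g0 by (intro sum_mono2) auto
      finally have a: "(\<Sum>j<n. norm (S j)) \<le> (\<Sum>j<N. g j)" .
      have "(\<Sum>j<n. norm (w (real j * h + h))) \<le> (\<Sum>j<N. norm (w (real j * h + h)))" using n by (intro sum_mono2) auto
      then have b: "h * (\<Sum>j<n. norm (w (real j * h + h))) \<le> E" unfolding E_def using h(1) by (intro mult_left_mono) auto
      show "(\<Sum>j<n. norm (S j)) + integral {0..T} (\<lambda>s. norm (w s)) + T * (C1 * Z) + h * (\<Sum>j<n. norm (w (real j * h + h))) \<le> Z + T * (C1 * Z)"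
        using a b parts(3) unfolding J_def[symmetric] by linarith
    qed (use l h(1) in auto)
    also have "\<dots> = (C2 - 1) * h * Z" by (simp add: C2_def algebra_simps)
    finally have err: "norm (p (real n * h) - P n) + norm (q (real n * h) - Q n - S n) \<le> (C2 - 1) * h * Z" .
    have "norm (S n) \<le> h * Z" using Sg[OF n] parts(4) h(1) by (simp add: field_simps)
    then have "norm (p (real n * h) - P n) + norm (q (real n * h) - Q n) \<le> C2 * h * Z"
      using err norm_triangle_ineq[of "q (real n * h) - Q n - S n" "S n"] by (simp add: algebra_simps)
    also have "\<dots> \<le> (C1 + 1 + C2) * h * Z" using C1 h(1) Z1 by (intro mult_right_mono) auto
    finally have e2: "norm ((p (real n * h), q (real n * h)) - (P n, Q n)) \<le> (C1 + 1 + C2) * h * Z"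
      using norm_Pair_le[of "p (real n * h) - P n" "q (real n * h) - Q n"] by simp
    have "norm (p (real n * h)) + norm (q (real n * h)) \<le> exp (l * T) * (1 + T * v) * Z + Z"
      using bound[OF nT] parts(2) norm_triangle_ineq[of "p (real n * h) - w (real n * h)" "w (real n * h)"] by simp
    also have "\<dots> \<le> C1 * Z + Z" unfolding C1Z[symmetric] using v Z1 by simp
    also have "\<dots> \<le> (C1 + 1 + C2) * Z" using C2 Z1 by (simp add: algebra_simps)
    finally have e1: "norm (p (real n * h), q (real n * h)) \<le> (C1 + 1 + C2) * Z"
      using norm_Pair_le[of "p (real n * h)" "q (real n * h)"] by simp
    show ?case using e1 e2 by (simp add: Z_def)
  qed
qed

subsection \<open>Moments of time averages\<close>

lemma convex_on_power_nonneg: "convex_on {0::real..} (\<lambda>x. x ^ r)"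
  by (cases "even r") (auto intro: convex_power_odd convex_on_subset[OF convex_power_even])

text \<open>Jensen's inequality with equal weights.\<close>

lemma power_sum_le:
  fixes x :: "'i \<Rightarrow> real"
  assumes "finite I" "I \<noteq> {}" "\<And>i. i \<in> I \<Longrightarrow> 0 \<le> x i"
  shows "(\<Sum>i\<in>I. x i) ^ r \<le> real (card I) ^ r * ((\<Sum>i\<in>I. x i ^ r) / real (card I))"
proof -
  have c: "0 < real (card I)" using assms by (simp add: card_gt_0_iff)
  have "(\<Sum>i\<in>I. (1 / real (card I)) *\<^sub>R x i) ^ r \<le> (\<Sum>i\<in>I. (1 / real (card I)) * x i ^ r)"
    using assms c by (intro convex_on_sum[OF _ _ convex_on_power_nonneg]) auto
  then have "((\<Sum>i\<in>I. x i) / real (card I)) ^ r \<le> (\<Sum>i\<in>I. x i ^ r) / real (card I)"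
    by (simp flip: sum_divide_distrib)
  then show ?thesis using c by (simp add: power_divide field_simps)
qed

text \<open>The nonnegative integral with an explicit constant carries integrability and bound at
  once, and makes uniformity in \<open>h\<close> visible. With \<open>0 <= c\<close>, the conversion
  \<open>ennreal c\<close> does not truncate.\<close>

definition moment_le :: "'a measure \<Rightarrow> nat \<Rightarrow> real \<Rightarrow> ('a \<Rightarrow> real) \<Rightarrow> bool" where
  "moment_le M r c X \<longleftrightarrow> X \<in> borel_measurable M \<and> (\<forall>\<omega>\<in>space M. 0 \<le> X \<omega>) \<and> 0 \<le> c \<and>
     (\<integral>\<^sup>+\<omega>. ennreal (X \<omega> ^ r) \<partial>M) \<le> ennreal c"

lemma moment_leD:
  assumes "moment_le M r c X"
  shows "X \<in> borel_measurable M" "\<And>\<omega>. \<omega> \<in> space M \<Longrightarrow> 0 \<le> X \<omega>" "0 \<le> c"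
    "(\<integral>\<^sup>+\<omega>. ennreal (X \<omega> ^ r) \<partial>M) \<le> ennreal c"
  using assms by (auto simp: moment_le_def)

lemma moment_le_mono:
  assumes Y: "moment_le M r c Y" and X: "X \<in> borel_measurable M"
    and le: "\<And>\<omega>. \<omega> \<in> space M \<Longrightarrow> 0 \<le> X \<omega> \<and> X \<omega> \<le> Y \<omega>" and cd: "c \<le> d"
  shows "moment_le M r d X"
proof -
  have "(\<integral>\<^sup>+\<omega>. ennreal (X \<omega> ^ r) \<partial>M) \<le> (\<integral>\<^sup>+\<omega>. ennreal (Y \<omega> ^ r) \<partial>M)"
    using le by (intro nn_integral_mono ennreal_leI power_mono) auto
  also have "\<dots> \<le> ennreal c" by (rule moment_leD[OF Y])
  also have "\<dots> \<le> ennreal d" using cd by (rule ennreal_leI)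
  finally show ?thesis using X le cd moment_leD(3)[OF Y] by (auto simp: moment_le_def)
qed

lemma moment_le_scale:
  assumes "moment_le M r c X" "0 \<le> a"
  shows "moment_le M r (a ^ r * c) (\<lambda>\<omega>. a * X \<omega>)"
proof -
  note [measurable] = moment_leD(1)[OF assms(1)]
  have "(\<integral>\<^sup>+\<omega>. ennreal ((a * X \<omega>) ^ r) \<partial>M) = (\<integral>\<^sup>+\<omega>. ennreal (a ^ r) * ennreal (X \<omega> ^ r) \<partial>M)"
    using assms by (intro nn_integral_cong) (auto simp: power_mult_distrib ennreal_mult moment_leD(2))
  also have "\<dots> = ennreal (a ^ r) * (\<integral>\<^sup>+\<omega>. ennreal (X \<omega> ^ r) \<partial>M)"
    by (rule nn_integral_cmult) measurable
  also have "\<dots> \<le> ennreal (a ^ r) * ennreal c"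
    by (intro mult_left_mono moment_leD(4)[OF assms(1)]) auto
  also have "\<dots> = ennreal (a ^ r * c)" using assms by (simp add: ennreal_mult moment_leD(3))
  finally show ?thesis using assms moment_leD[OF assms(1)] by (auto simp: moment_le_def)
qed

text \<open>Convexity of the power alone gives the factor \<open>real (card I) ^ r\<close>. In the
  applications to grids and Riemann sums it is compensated by weights such as \<open>h\<close> or
  \<open>1 / real (Suc n)\<close>.\<close>

lemma moment_le_sum:
  assumes fin: "finite I" and X: "\<And>i. i \<in> I \<Longrightarrow> moment_le M r c (X i)" and r: "0 < r"
    and c: "0 \<le> c"
  shows "moment_le M r (real (card I) ^ r * c) (\<lambda>\<omega>. \<Sum>i\<in>I. X i \<omega>)"
proof (cases "I = {}")
  case True
  then show ?thesis using r by (simp add: moment_le_def zero_power)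
next
  case False
  note [measurable] = moment_leD(1)[OF X]
  let ?n = "real (card I)"
  have n: "0 < ?n" using fin False by (simp add: card_gt_0_iff)
  have "(\<integral>\<^sup>+\<omega>. ennreal ((\<Sum>i\<in>I. X i \<omega>) ^ r) \<partial>M) \<le> (\<integral>\<^sup>+\<omega>. ennreal (?n ^ r / ?n) * (\<Sum>i\<in>I. ennreal (X i \<omega> ^ r)) \<partial>M)"
  proof (intro nn_integral_mono)
    fix \<omega> assume "\<omega> \<in> space M"
    then have pos: "0 \<le> X i \<omega>" if "i \<in> I" for i using moment_leD(2)[OF X[OF that]] by simp
    have "(\<Sum>i\<in>I. X i \<omega>) ^ r \<le> (?n ^ r / ?n) * (\<Sum>i\<in>I. X i \<omega> ^ r)"
      using power_sum_le[OF fin False pos, where r = r] by simp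
    then have "ennreal ((\<Sum>i\<in>I. X i \<omega>) ^ r) \<le> ennreal ((?n ^ r / ?n) * (\<Sum>i\<in>I. X i \<omega> ^ r))" by (rule ennreal_leI)
    also have "\<dots> = ennreal (?n ^ r / ?n) * ennreal (\<Sum>i\<in>I. X i \<omega> ^ r)"
      using pos by (intro ennreal_mult sum_nonneg) auto
    also have "ennreal (\<Sum>i\<in>I. X i \<omega> ^ r) = (\<Sum>i\<in>I. ennreal (X i \<omega> ^ r))"
      using pos by (intro sum_ennreal[symmetric]) auto
    finally show "ennreal ((\<Sum>i\<in>I. X i \<omega>) ^ r) \<le> ennreal (?n ^ r / ?n) * (\<Sum>i\<in>I. ennreal (X i \<omega> ^ r))" .
  qed
  also have "\<dots> = ennreal (?n ^ r / ?n) * (\<Sum>i\<in>I. (\<integral>\<^sup>+\<omega>. ennreal (X i \<omega> ^ r) \<partial>M))"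
    by (subst nn_integral_cmult) (auto intro!: borel_measurable_sum simp: nn_integral_sum)
  also have "\<dots> \<le> ennreal (?n ^ r / ?n) * (\<Sum>i\<in>I. ennreal c)"
    by (intro mult_left_mono sum_mono moment_leD(4)[OF X]) auto
  also have "\<dots> = ennreal (?n ^ r / ?n * (?n * c))"
    using c by (simp add: ennreal_mult ennreal_of_nat_eq_real_of_nat flip: ennreal_mult)
  also have "?n ^ r / ?n * (?n * c) = ?n ^ r * c" using n by simp
  finally show ?thesis using c X by (auto simp: moment_le_def intro!: sum_nonneg borel_measurable_sum)
qed

lemma moment_le_add:
  assumes "moment_le M r c X" "moment_le M r d Y" "0 < r"
  shows "moment_le M r (2 ^ r * (c + d)) (\<lambda>\<omega>. X \<omega> + Y \<omega>)"
proof -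
  \<comment> \<open>Two summands are a sum over \<open>bool\<close>; \<open>c + d\<close> is the
    common moment bound that the sum lemma expects.\<close>
  have "moment_le M r (real (card (UNIV :: bool set)) ^ r * (c + d)) (\<lambda>\<omega>. \<Sum>b\<in>UNIV. if b then X \<omega> else Y \<omega>)"
  proof (rule moment_le_sum[OF _ _ assms(3)])
    note X = moment_leD[OF assms(1)] and Y = moment_leD[OF assms(2)]
    show "moment_le M r (c + d) (\<lambda>\<omega>. if b then X \<omega> else Y \<omega>)" for b
      using moment_le_mono[OF assms(1) X(1), of "c + d"] moment_le_mono[OF assms(2) Y(1), of "c + d"] X Y
      by (cases b) auto
  qed (use moment_leD(3)[OF assms(1)] moment_leD(3)[OF assms(2)] in auto)
  then show ?thesis by (simp add: UNIV_bool add.commute)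
qed

text \<open>By uniform continuity \<open>g\<close> varies by less than \<open>e / 2\<close> on each
  cell once the mesh is below \<open>d\<close>, so each cell contributes an error of at most
  \<open>e / 2\<close> times its length.\<close>

lemma riemann_sum_tendsto:
  fixes g :: "real \<Rightarrow> real"
  assumes a: "0 < a" and cg: "continuous_on {0..a} g"
  shows "(\<lambda>n. (\<Sum>i<Suc n. g (real i * (a / real (Suc n)))) / real (Suc n)) \<longlonglongrightarrow> integral {0..a} g / a"
proof (rule LIMSEQ_I)
  fix e :: real assume e: "0 < e"
  have "uniformly_continuous_on {0..a} g" using cg compact_Icc by (rule compact_uniformly_continuous)
  then obtain d where d: "0 < d" "\<And>x y. x \<in> {0..a} \<Longrightarrow> y \<in> {0..a} \<Longrightarrow> dist y x < d \<Longrightarrow> dist (g y) (g x) < e / 2"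
    using e unfolding uniformly_continuous_on_def by (metis half_gt_zero)
  obtain n0 where n0: "a / d < real n0" using reals_Archimedean2 by blast
  show "\<exists>n0. \<forall>n\<ge>n0. norm ((\<Sum>i<Suc n. g (real i * (a / real (Suc n)))) / real (Suc n) - integral {0..a} g / a) < e"
  proof (intro exI allI impI)
    fix n assume n: "n0 \<le> n"
    define h where "h = a / real (Suc n)"
    have h: "0 < h" using a by (simp add: h_def)
    have "a / d < real (Suc n)" using n0 n by linarith
    then have hd: "h < d" using d(1) by (simp add: h_def field_simps)
    have na: "real (Suc n) * h = a" by (simp add: h_def)
    have sub: "{real i * h..real i * h + h} \<subseteq> {0..a}" if "i < Suc n" for i
    proof -
      have "(real i + 1) * h \<le> real (Suc n) * h" using that h by (intro mult_right_mono) auto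
      then show ?thesis using h na by (auto simp: algebra_simps)
    qed
    have "h * (\<Sum>i<Suc n. g (real i * h)) - integral {0..a} g = (\<Sum>i<Suc n. h * g (real i * h) - integral {real i * h..real i * h + h} g)"
      using integral_grid_sum[of h "Suc n" g] cg h unfolding na by (simp only: sum_subtractf sum_distrib_left)
    also have "norm \<dots> \<le> (\<Sum>i<Suc n. e / 2 * h)"
    proof (rule sum_norm_le)
      fix i assume "i \<in> {..<Suc n}"
      then have s: "{real i * h..real i * h + h} \<subseteq> {0..a}" using sub by auto
      note c = continuous_on_subset[OF cg s]
      have "h * g (real i * h) - integral {real i * h..real i * h + h} g = integral {real i * h..real i * h + h} (\<lambda>x. g (real i * h) - g x)"
        using h by (subst integral_diff) (auto intro!: integrable_continuous_real c)
      also have "norm \<dots> \<le> e / 2 * (real i * h + h - real i * h)"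
      proof (rule integral_bound)
        fix x assume x: "x \<in> {real i * h..real i * h + h}"
        have "dist (g (real i * h)) (g x) < e / 2" using x hd h subsetD[OF s x] by (intro d(2)) (auto simp: dist_real_def subsetD[OF s])
        then show "norm (g (real i * h) - g x) \<le> e / 2" by (simp add: dist_norm)
      qed (use h c in \<open>auto intro!: continuous_intros\<close>)
      finally show "norm (h * g (real i * h) - integral {real i * h..real i * h + h} g) \<le> e / 2 * h" by simp
    qed
    also have "\<dots> = e / 2 * (real (Suc n) * h)" by (simp del: sum.lessThan_Suc of_nat_Suc)
    also note na
    finally have "norm (h * (\<Sum>i<Suc n. g (real i * h)) - integral {0..a} g) \<le> e / 2 * a" .
    moreover have "(\<Sum>i<Suc n. g (real i * h)) / real (Suc n) - integral {0..a} g / a = (h * (\<Sum>i<Suc n. g (real i * h)) - integral {0..a} g) / a"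
      using a by (simp add: h_def field_simps del: sum.lessThan_Suc)
    ultimately have "norm ((\<Sum>i<Suc n. g (real i * h)) / real (Suc n) - integral {0..a} g / a) \<le> e / 2"
      using a by (simp only: norm_divide) (simp add: pos_divide_le_eq del: sum.lessThan_Suc)
    then show "norm ((\<Sum>i<Suc n. g (real i * (a / real (Suc n)))) / real (Suc n) - integral {0..a} g / a) < e"
      using e unfolding h_def by linarith
  qed
qed

text \<open>Jensen's inequality for the time average. Passing through Riemann sums and Fatou's lemma
  avoids the joint measurability of \<open>g\<close> in time and \<open>\<omega>\<close>.\<close>

lemma moment_le_integral_average:
  fixes g :: "real \<Rightarrow> 'a \<Rightarrow> real"
  assumes a: "0 < a" and r: "0 < r"
    and g: "\<And>u. 0 \<le> u \<Longrightarrow> u < a \<Longrightarrow> moment_le M r c (g u)"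
    and cont: "\<And>\<omega>. \<omega> \<in> space M \<Longrightarrow> continuous_on {0..a} (\<lambda>u. g u \<omega>)"
  shows "moment_le M r c (\<lambda>\<omega>. integral {0..a} (\<lambda>u. g u \<omega>) / a)"
proof -
  \<comment> \<open>Left endpoints \<open>i * a / (n + 1)\<close> with \<open>i <= n\<close> stay
    strictly below \<open>a\<close>, the range in which moments of \<open>g\<close> are assumed. For
    the noise defect, \<open>u = h\<close> would be a degenerate Gaussian.\<close>
  define A where "A n \<omega> = (\<Sum>i<Suc n. g (real i * (a / real (Suc n))) \<omega>) / real (Suc n)" for n \<omega>
  have c: "0 \<le> c" using g[of 0] a moment_leD(3) by blast
  have A: "moment_le M r c (A n)" for n
  proof -
    have "moment_le M r c (g (real i * (a / real (Suc n))))" if "i \<in> {..<Suc n}" for i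
    proof (rule g)
      have "real i * a < real (Suc n) * a" using that a by (intro mult_strict_right_mono) auto
      then show "real i * (a / real (Suc n)) < a" by (simp add: field_simps)
    qed (use a in auto)
    then have "moment_le M r ((1 / real (Suc n)) ^ r * (real (card {..<Suc n}) ^ r * c))
       (\<lambda>\<omega>. 1 / real (Suc n) * (\<Sum>i<Suc n. g (real i * (a / real (Suc n))) \<omega>))"
      by (intro moment_le_scale moment_le_sum r c) auto
    moreover have "(1 / real (Suc n)) ^ r * (real (card {..<Suc n}) ^ r * c) = c"
      by (simp add: power_divide del: of_nat_Suc)
    ultimately show ?thesis unfolding A_def by (simp only: mult_1 times_divide_eq_left)
  qed
  have lim: "(\<lambda>n. A n \<omega>) \<longlonglongrightarrow> integral {0..a} (\<lambda>u. g u \<omega>) / a" if "\<omega> \<in> space M" for \<omega>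
    unfolding A_def by (rule riemann_sum_tendsto[OF a cont[OF that]])
  note [measurable] = moment_leD(1)[OF A]
  have meas: "(\<lambda>\<omega>. integral {0..a} (\<lambda>u. g u \<omega>) / a) \<in> borel_measurable M"
    by (rule borel_measurable_LIMSEQ_real[OF lim]) measurable
  have pos: "0 \<le> integral {0..a} (\<lambda>u. g u \<omega>) / a" if "\<omega> \<in> space M" for \<omega>
    using LIMSEQ_le_const[OF lim[OF that]] moment_leD(2)[OF A that] by blast
  have "(\<integral>\<^sup>+\<omega>. ennreal ((integral {0..a} (\<lambda>u. g u \<omega>) / a) ^ r) \<partial>M) = (\<integral>\<^sup>+\<omega>. liminf (\<lambda>n. ennreal (A n \<omega> ^ r)) \<partial>M)"
  proof (intro nn_integral_cong)
    fix \<omega> assume "\<omega> \<in> space M"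
    then have "(\<lambda>n. ennreal (A n \<omega> ^ r)) \<longlonglongrightarrow> ennreal ((integral {0..a} (\<lambda>u. g u \<omega>) / a) ^ r)"
      by (intro tendsto_ennrealI tendsto_power lim)
    then show "ennreal ((integral {0..a} (\<lambda>u. g u \<omega>) / a) ^ r) = liminf (\<lambda>n. ennreal (A n \<omega> ^ r))"
      by (intro lim_imp_Liminf[symmetric]) auto
  qed
  also have "\<dots> \<le> liminf (\<lambda>n. \<integral>\<^sup>+\<omega>. ennreal (A n \<omega> ^ r) \<partial>M)"
    by (intro nn_integral_liminf) measurable
  also have "\<dots> \<le> ennreal c"
  proof -
    have "liminf (\<lambda>n. \<integral>\<^sup>+\<omega>. ennreal (A n \<omega> ^ r) \<partial>M) \<le> liminf (\<lambda>n::nat. ennreal c)"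
      by (intro Liminf_mono always_eventually allI moment_leD(4)[OF A])
    then show ?thesis by (simp add: Liminf_const)
  qed
  finally show ?thesis using meas pos c by (simp add: moment_le_def)
qed

section \<open>Independence and Gaussian moments\<close>

text \<open>A bridge from independence of sigma-algebras, as in the definition of Brownian motion,
  to \<open>indep_var\<close>, as needed for sums of normal variables. The sigma-algebras generated
  by \<open>X\<close> and \<open>g (D \<omega>)\<close> lie inside the two independent ones and
  inherit the product formula.\<close>

lemma (in prob_space) indep_var_subalgebra:
  fixes X :: "'a \<Rightarrow> real" and g :: "'b::topological_space \<Rightarrow> real"
  assumes G: "subalgebra M G" and X: "X \<in> borel_measurable G"
    and D: "D \<in> borel_measurable M" and g: "g \<in> borel_measurable borel"
    and indep: "indep_set (sets G) (sets (vimage_algebra (space M) D borel))"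
  shows "indep_var borel X borel (\<lambda>\<omega>. g (D \<omega>))"
proof -
  have *: "sigma_sets (space M) {Y -` A \<inter> space M |A. A \<in> sets borel} \<subseteq> sets H"
    if "Y \<in> borel_measurable H" "space H = space M" for Y :: "'a \<Rightarrow> real" and H
  proof -
    have "{Y -` A \<inter> space M |A. A \<in> sets borel} \<subseteq> sets H"
      using measurable_sets[OF that(1)] by (auto simp: that(2))
    from sets.sigma_sets_subset[OF this] show ?thesis by (simp add: that(2))
  qed
  have 1: "sigma_sets (space M) {X -` A \<inter> space M |A. A \<in> sets borel} \<subseteq> sets G"
    using G by (intro *[OF X]) (simp add: subalgebra_def)
  have "D \<in> vimage_algebra (space M) D borel \<rightarrow>\<^sub>M borel" by (rule measurable_vimage_algebra1) simp
  then have 2: "sigma_sets (space M) {(\<lambda>\<omega>. g (D \<omega>)) -` A \<inter> space M |A. A \<in> sets borel} \<subseteq> sets (vimage_algebra (space M) D borel)"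
    by (intro *[OF measurable_compose[OF _ g]]) auto
  have "indep_set (sigma_sets (space M) {X -` A \<inter> space M |A. A \<in> sets borel}) (sigma_sets (space M) {(\<lambda>\<omega>. g (D \<omega>)) -` A \<inter> space M |A. A \<in> sets borel})"
    (is "indep_set ?A ?B")
    unfolding indep_sets2_eq
  proof (intro conjI ballI)
    note ind = indep[unfolded indep_sets2_eq]
    show "?A \<subseteq> events" by (rule order_trans[OF 1 conjunct1[OF ind]])
    show "?B \<subseteq> events" by (rule order_trans[OF 2 conjunct1[OF conjunct2[OF ind]]])
    show "prob (a \<inter> b) = prob a * prob b" if "a \<in> ?A" "b \<in> ?B" for a b
      by (rule bspec[OF bspec[OF conjunct2[OF conjunct2[OF ind]] subsetD[OF 1 that(1)]] subsetD[OF 2 that(2)]])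
  qed
  then show ?thesis
    unfolding indep_var_eq using measurable_from_subalg[OF G X] measurable_compose[OF D g] by blast
qed

text \<open>Even moments of a centred normal variable have a closed form, and the bound of
  \<open>\<bar>x\<bar> ^ r\<close> by \<open>1 + x ^ (2 * r)\<close> reduces every order to them.
  The result depends on the variance only through its upper bound \<open>T\<close>.\<close>

lemma normal_distributed_moment_le:
  assumes X: "distributed M lborel X (\<lambda>x. ennreal (normal_density 0 \<sigma> x))"
    and \<sigma>: "0 < \<sigma>" "\<sigma>\<^sup>2 \<le> T"
  shows "moment_le M r (1 + fact (2 * r) / (2 ^ r * fact r) * T ^ r) (\<lambda>\<omega>. \<bar>X \<omega>\<bar>)"
proof -
  have T: "0 \<le> T" using \<sigma>(2) by (rule order_trans[OF zero_le_power2])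
  have Xm: "X \<in> borel_measurable M" using distributed_measurable[OF X] by simp
  \<comment> \<open>The exponent \<open>2 * 0\<close> presents the total mass as an even moment, so
    both summands come from one formula.\<close>
  have hb: "has_bochner_integral lborel (\<lambda>x. normal_density 0 \<sigma> x * (x - 0) ^ (2 * 0) + normal_density 0 \<sigma> x * (x - 0) ^ (2 * r))
     (fact (2 * 0) / ((2 / \<sigma>\<^sup>2) ^ 0 * fact 0) + fact (2 * r) / ((2 / \<sigma>\<^sup>2)^r * fact r))"
    by (intro has_bochner_integral_add normal_moment_even \<sigma>)
  have "(\<integral>\<^sup>+\<omega>. ennreal (\<bar>X \<omega>\<bar> ^ r) \<partial>M) = (\<integral>\<^sup>+x. ennreal (normal_density 0 \<sigma> x) * ennreal (\<bar>x\<bar> ^ r) \<partial>lborel)"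
    by (rule distributed_nn_integral[OF X, symmetric]) simp
  also have "\<dots> \<le> (\<integral>\<^sup>+x. ennreal (normal_density 0 \<sigma> x * (x - 0) ^ (2 * 0) + normal_density 0 \<sigma> x * (x - 0) ^ (2 * r)) \<partial>lborel)"
  proof (intro nn_integral_mono)
    fix x :: real
    \<comment> \<open>For \<open>a = \<bar>x\<bar> ^ r\<close>, the inequality
      \<open>(a - 1/2)^2 >= 0\<close> gives \<open>a <= a^2 + 1/4\<close>.\<close>
    have "\<bar>x\<bar> ^ r \<le> 1 + (\<bar>x\<bar> ^ r)\<^sup>2"
      using zero_le_power2[of "\<bar>x\<bar> ^ r - 1 / 2"] by (simp add: power2_diff power_divide)
    also have "(\<bar>x\<bar> ^ r)\<^sup>2 = x ^ (2 * r)" by (simp add: power_even_abs flip: power_mult mult.commute[of 2])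
    finally have "normal_density 0 \<sigma> x * \<bar>x\<bar> ^ r \<le> normal_density 0 \<sigma> x * (1 + x ^ (2 * r))"
      by (intro mult_left_mono) auto
    then have "ennreal (normal_density 0 \<sigma> x * \<bar>x\<bar> ^ r) \<le> ennreal (normal_density 0 \<sigma> x * (1 + x ^ (2 * r)))"
      by (rule ennreal_leI)
    then show "ennreal (normal_density 0 \<sigma> x) * ennreal (\<bar>x\<bar> ^ r) \<le> ennreal (normal_density 0 \<sigma> x * (x - 0) ^ (2 * 0) + normal_density 0 \<sigma> x * (x - 0) ^ (2 * r))"
      by (simp add: ennreal_mult distrib_left)
  qed
  also have "\<dots> = ennreal (1 + fact (2 * r) / ((2 / \<sigma>\<^sup>2)^r * fact r))"
    using hb by (subst nn_integral_eq_integral) (auto simp: has_bochner_integral_iff power_mult)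
  also have "\<dots> \<le> ennreal (1 + fact (2 * r) / (2 ^ r * fact r) * T ^ r)"
  proof (intro ennreal_leI add_left_mono)
    have "fact (2 * r) / ((2 / \<sigma>\<^sup>2)^r * fact r) = fact (2 * r) / (2 ^ r * fact r) * (\<sigma>\<^sup>2) ^ r"
      by (simp add: power_divide)
    also have "\<dots> \<le> fact (2 * r) / (2 ^ r * fact r) * T ^ r"
      using \<sigma> by (intro mult_left_mono power_mono) auto
    finally show "fact (2 * r) / ((2 / \<sigma>\<^sup>2)^r * fact r) \<le> fact (2 * r) / (2 ^ r * fact r) * T ^ r" .
  qed
  finally show ?thesis using Xm T by (auto simp: moment_le_def)
qed

subsection \<open>Moments of the Brownian noise\<close>

lemma moment_le_integral:
  assumes "moment_le M r c X"
  shows "integrable M (\<lambda>\<omega>. X \<omega> ^ r)" "(LINT \<omega>|M. X \<omega> ^ r) \<le> c"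
proof -
  note X = moment_leD[OF assms]
  note [measurable] = X(1)
  have pos: "AE \<omega> in M. 0 \<le> X \<omega> ^ r" using X(2) by (intro AE_I2) auto
  show int: "integrable M (\<lambda>\<omega>. X \<omega> ^ r)"
    using X(4) pos by (intro integrableI_nonneg) (auto intro: le_less_trans)
  have "ennreal (LINT \<omega>|M. X \<omega> ^ r) \<le> ennreal c"
    using nn_integral_eq_integral[OF int pos] X(4) by simp
  then show "(LINT \<omega>|M. X \<omega> ^ r) \<le> c" using X(3) by (simp add: ennreal_le_iff)
qed

lemma (in prob_space) moment_le_one: "moment_le M r 1 (\<lambda>_. 1)"
  by (simp add: moment_le_def emeasure_space_1)

text \<open>The operator norm and the l1 norm reduce vector moments to those of real Gaussian
  coordinates.\<close>

lemma moment_le_matrix_vector: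
  fixes A :: "real^'d^'m" and X :: "'a \<Rightarrow> real^'d"
  assumes X: "\<And>i. moment_le M r c (\<lambda>\<omega>. \<bar>X \<omega> $ i\<bar>)" and meas: "X \<in> borel_measurable M" and r: "0 < r"
  shows "moment_le M r (onorm ((*v) A) ^ r * (real CARD('d) ^ r * c)) (\<lambda>\<omega>. norm (A *v X \<omega>))"
proof -
  have bl: "bounded_linear ((*v) A)" by simp
  have c: "0 \<le> c" by (rule moment_leD(3)[OF X])
  have "moment_le M r (onorm ((*v) A) ^ r * (real CARD('d) ^ r * c)) (\<lambda>\<omega>. onorm ((*v) A) * (\<Sum>i\<in>UNIV. \<bar>X \<omega> $ i\<bar>))"
    by (intro moment_le_scale moment_le_sum X r c onorm_pos_le[OF bl]) auto
  then show ?thesis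
  proof (rule moment_le_mono)
    have "(\<lambda>x. norm (A *v x)) \<in> borel_measurable borel"
      by (intro borel_measurable_continuous_onI continuous_on_norm bounded_linear.continuous_on[OF bl] continuous_on_id)
    from measurable_compose[OF meas this] show "(\<lambda>\<omega>. norm (A *v X \<omega>)) \<in> borel_measurable M" .
    show "0 \<le> norm (A *v X \<omega>) \<and> norm (A *v X \<omega>) \<le> onorm ((*v) A) * (\<Sum>i\<in>UNIV. \<bar>X \<omega> $ i\<bar>)" for \<omega>
      using onorm[OF bl, of "X \<omega>"] mult_left_mono[OF norm_le_l1_cart[of "X \<omega>"] onorm_pos_le[OF bl]] by simp
  qed simp
qed

lemma brownian_motion_measurable:
  assumes "normal_filtration M T F" "brownian_motion M T F W" "t \<in> {0..T}"
  shows "W t \<in> borel_measurable (F t)" "W t \<in> borel_measurable M"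
proof -
  show 1: "W t \<in> borel_measurable (F t)" using assms by (simp add: brownian_motion_def)
  show "W t \<in> borel_measurable M"
    using assms by (intro measurable_from_subalg[OF _ 1]) (simp add: normal_filtration_def)
qed

lemma filtration_measurable_mono:
  assumes "normal_filtration M T F" "0 \<le> s" "s \<le> t" "t \<le> T" "X \<in> borel_measurable (F s)"
  shows "X \<in> borel_measurable (F t)"
proof -
  have "subalgebra (F t) (F s)" using assms(1-4) by (auto simp: normal_filtration_def subalgebra_def)
  then show ?thesis using assms(5) by (rule measurable_from_subalg)
qed

text \<open>Induction on \<open>n\<close>: the first \<open>n\<close> increments are known at time
  \<open>n * h + u\<close>, where the next one starts, hence independent of it, and the variances
  add up. The conditions \<open>0 < n\<close> and \<open>u < h\<close> keep the variance positive,
  so that a density exists.\<close>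

lemma brownian_increment_sum_normal:
  fixes W :: "real \<Rightarrow> 'a \<Rightarrow> real^'d"
  assumes M: "prob_space M" and F: "normal_filtration M T F" and W: "brownian_motion M T F W"
    and u: "0 \<le> u" "u < h" and n: "0 < n" "real n * h \<le> T"
  shows "distributed M lborel (\<lambda>\<omega>. \<Sum>i<n. (W (real i * h + h) \<omega> - W (real i * h + u) \<omega>) $ c)
     (\<lambda>x. ennreal (normal_density 0 (sqrt (real n * (h - u))) x))"
  using n
proof (induction n)
  case (Suc n)
  interpret prob_space M by fact
  let ?s = "real n * h + u" and ?t = "real n * h + h"
  have nh: "0 \<le> real n * h" using u by simp
  have tT: "?t \<le> T" using Suc.prems by (simp add: algebra_simps)
  have st: "0 \<le> ?s" "?s < ?t" using nh u by auto
  have inc: "indep_set (sets (F ?s)) (sets (vimage_algebra (space M) (\<lambda>\<omega>. W ?t \<omega> - W ?s \<omega>) borel))"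
    "distributed M lborel (\<lambda>\<omega>. (W ?t \<omega> - W ?s \<omega>) $ c) (\<lambda>x. ennreal (normal_density 0 (sqrt (?t - ?s)) x))"
    using W st tT unfolding brownian_motion_def by blast+
  show ?case
  proof (cases "n = 0")
    case True
    then show ?thesis using inc(2) by simp
  next
    case False
    let ?X = "\<lambda>\<omega>. \<Sum>i<n. (W (real i * h + h) \<omega> - W (real i * h + u) \<omega>) $ c"
    have "real n * h \<le> T" using tT u by simp
    with Suc.IH False have IH: "distributed M lborel ?X (\<lambda>x. ennreal (normal_density 0 (sqrt (real n * (h - u))) x))" by simp
    \<comment> \<open>All earlier intervals end no later than \<open>real n * h\<close>, hence not
      after \<open>?s\<close>.\<close>
    have Xm: "?X \<in> borel_measurable (F ?s)"
    proof (intro borel_measurable_sum)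
      fix i assume i: "i \<in> {..<n}"
      then have "(real i + 1) * h \<le> real n * h" using u by (intro mult_right_mono) auto
      then have le: "real i * h + u \<le> ?s" "real i * h + h \<le> ?s" "0 \<le> real i * h" using u i by (auto simp: algebra_simps)
      have "W (real i * h + u) \<in> borel_measurable (F ?s)" "W (real i * h + h) \<in> borel_measurable (F ?s)"
        using le u st tT
        by (auto intro!: filtration_measurable_mono[OF F _ _ _ brownian_motion_measurable(1)[OF F W]])
      then have "(\<lambda>\<omega>. W (real i * h + h) \<omega> - W (real i * h + u) \<omega>) \<in> borel_measurable (F ?s)"
        by (intro borel_measurable_diff)
      then show "(\<lambda>\<omega>. (W (real i * h + h) \<omega> - W (real i * h + u) \<omega>) $ c) \<in> borel_measurable (F ?s)"
        by (rule measurable_compose) (intro borel_measurable_continuous_onI continuous_intros)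
    qed
    have sub: "subalgebra M (F ?s)" using F st tT by (simp add: normal_filtration_def)
    have Dm: "(\<lambda>\<omega>. W ?t \<omega> - W ?s \<omega>) \<in> borel_measurable M"
      using st tT by (intro borel_measurable_diff brownian_motion_measurable(2)[OF F W]) auto
    have "indep_var borel ?X borel (\<lambda>\<omega>. (W ?t \<omega> - W ?s \<omega>) $ c)"
      by (intro indep_var_subalgebra[OF sub Xm Dm _ inc(1)] borel_measurable_continuous_onI continuous_intros)
    from add_indep_normal[OF this _ _ IH inc(2)]
    have "distributed M lborel (\<lambda>\<omega>. ?X \<omega> + (W ?t \<omega> - W ?s \<omega>) $ c)
        (\<lambda>x. ennreal (normal_density (0 + 0) (sqrt ((sqrt (real n * (h - u)))\<^sup>2 + (sqrt (?t - ?s))\<^sup>2)) x))"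
      using u False by simp
    moreover have "(sqrt (real n * (h - u)))\<^sup>2 + (sqrt (?t - ?s))\<^sup>2 = real (Suc n) * (h - u)"
      using u by (simp add: real_sqrt_pow2 mult_nonneg_nonneg) (simp add: algebra_simps)
    ultimately show ?thesis by simp
  qed
qed simp

text \<open>The variances \<open>t\<close> and \<open>n * (h - u)\<close> per coordinate are both at
  most \<open>T\<close>, so one constant serves both bounds. The second is the decisive
  cancellation: the triangle inequality in mean square would only give
  \<open>n^2 * (h - u)\<close>.\<close>

lemma brownian_noise_moments:
  fixes W :: "real \<Rightarrow> 'a \<Rightarrow> real^'d" and A :: "real^'d^'m"
  assumes M: "prob_space M" and F: "normal_filtration M T F" and W: "brownian_motion M T F W"
    and T: "0 < T" and r: "0 < r"
  obtains c where "\<And>t. t \<in> {0..T} \<Longrightarrow> moment_le M r c (\<lambda>\<omega>. norm (A *v (W t \<omega> - W 0 \<omega>)))"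
    "\<And>h n u. 0 \<le> u \<Longrightarrow> u < h \<Longrightarrow> real n * h \<le> T \<Longrightarrow>
       moment_le M r c (\<lambda>\<omega>. norm (\<Sum>i<n. A *v (W (real i * h + u) \<omega> - W 0 \<omega>) - A *v (W (real i * h + h) \<omega> - W 0 \<omega>)))"
proof -
  define b where "b = 1 + fact (2 * r) / (2 ^ r * fact r) * T ^ r"
  have b: "0 \<le> b" using T by (simp add: b_def)
  have zero: "moment_le M r b (\<lambda>\<omega>. 0)" using b r by (simp add: moment_le_def zero_power)
  note Wm = brownian_motion_measurable(2)[OF F W]
  show ?thesis
  proof (rule that[of "onorm ((*v) A) ^ r * (real CARD('d) ^ r * b)"])
    fix t assume t: "t \<in> {0..T}"
    show "moment_le M r (onorm ((*v) A) ^ r * (real CARD('d) ^ r * b)) (\<lambda>\<omega>. norm (A *v (W t \<omega> - W 0 \<omega>)))"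
    proof (rule moment_le_matrix_vector[OF _ _ r])
      show "(\<lambda>\<omega>. W t \<omega> - W 0 \<omega>) \<in> borel_measurable M" using t T by (intro borel_measurable_diff Wm) auto
      show "moment_le M r b (\<lambda>\<omega>. \<bar>(W t \<omega> - W 0 \<omega>) $ i\<bar>)" for i
      \<comment> \<open>A vanishing increment has no density and is treated separately; the same
        holds for the empty sum below.\<close>
      proof (cases "t = 0")
        case True then show ?thesis using zero by simp
      next
        case False
        then have "(0::real) \<le> 0" "0 < t" "t \<le> T" using t by auto
        then have "distributed M lborel (\<lambda>\<omega>. (W t \<omega> - W 0 \<omega>) $ i) (\<lambda>x. ennreal (normal_density 0 (sqrt (t - 0)) x))"
          using W unfolding brownian_motion_def by blast
        then show ?thesis unfolding b_def using False t by (intro normal_distributed_moment_le) auto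
      qed
    qed
  next
    fix h u :: real and n :: nat assume u: "0 \<le> u" "u < h" and n: "real n * h \<le> T"
    let ?X = "\<lambda>\<omega>. \<Sum>i<n. W (real i * h + h) \<omega> - W (real i * h + u) \<omega>"
    have mem: "real i * h + u \<in> {0..T}" "real i * h + h \<in> {0..T}" if "i < n" for i
    proof -
      have "(real i + 1) * h \<le> real n * h" "0 \<le> real i * h" using u that by (auto intro!: mult_right_mono)
      then show "real i * h + u \<in> {0..T}" "real i * h + h \<in> {0..T}" using u n by (auto simp: algebra_simps)
    qed
    have "moment_le M r (onorm ((*v) A) ^ r * (real CARD('d) ^ r * b)) (\<lambda>\<omega>. norm (A *v ?X \<omega>))"
    proof (rule moment_le_matrix_vector[OF _ _ r])
      show "?X \<in> borel_measurable M" using mem by (intro borel_measurable_sum borel_measurable_diff Wm) auto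
      show "moment_le M r b (\<lambda>\<omega>. \<bar>?X \<omega> $ i\<bar>)" for i
      proof (cases "n = 0")
        case True then show ?thesis using zero by simp
      next
        case False
        have "real n * (h - u) \<le> T" using n u by (smt (verit) mult_left_mono of_nat_0_le_iff)
        then have "moment_le M r b (\<lambda>\<omega>. \<bar>\<Sum>j<n. (W (real j * h + h) \<omega> - W (real j * h + u) \<omega>) $ i\<bar>)"
          unfolding b_def using False u
          by (intro normal_distributed_moment_le[OF brownian_increment_sum_normal[OF M F W u _ n]]) auto
        then show ?thesis by (simp add: sum_component)
      qed
    qed
    \<comment> \<open>\<open>W 0\<close> cancels, and the reversed orientation of the increments
      only changes the sign inside the norm.\<close>
    moreover have "(\<Sum>i<n. A *v (W (real i * h + u) \<omega> - W 0 \<omega>) - A *v (W (real i * h + h) \<omega> - W 0 \<omega>)) = - (A *v ?X \<omega>)" for \<omega>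
      by (simp add: matrix_vector_mult_diff_distrib matrix_vector_right_distrib linear_sum[OF matrix_vector_mul_linear] flip: sum_negf)
    ultimately show "moment_le M r (onorm ((*v) A) ^ r * (real CARD('d) ^ r * b))
      (\<lambda>\<omega>. norm (\<Sum>i<n. A *v (W (real i * h + u) \<omega> - W 0 \<omega>) - A *v (W (real i * h + h) \<omega> - W 0 \<omega>)))" by simp
  qed
qed

section \<open>From the pathwise estimate to the weak error\<close>

text \<open>Mean value inequality on the ball of radius \<open>R\<close>, which is convex and
  contains both points.\<close>

lemma derivative_poly_growth_lipschitz:
  fixes f :: "'a::euclidean_space \<Rightarrow> real"
  assumes "derivative_poly_growth k f" "\<And>x. f differentiable (at x)"
  obtains K where "0 \<le> K"
    "\<And>R x y. norm x \<le> R \<Longrightarrow> norm y \<le> R \<Longrightarrow> \<bar>f x - f y\<bar> \<le> K * (1 + R ^ k) * norm (x - y)"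
proof -
  obtain K where K: "\<And>x. onorm (frechet_derivative f (at x)) \<le> K * (1 + norm x ^ k)"
    using assms(1) unfolding derivative_poly_growth_def by blast
  show ?thesis
  proof (rule that[of "max K 0"])
    fix R and x y :: 'a assume xy: "norm x \<le> R" "norm y \<le> R"
    have "norm (f x - f y) \<le> max K 0 * (1 + R ^ k) * norm (x - y)"
    proof (rule differentiable_bound[OF convex_cball[of 0 R]])
      fix z :: 'a assume "z \<in> cball 0 R"
      then have "norm z ^ k \<le> R ^ k" by (intro power_mono) auto
      then have "K * (1 + norm z ^ k) \<le> max K 0 * (1 + R ^ k)" by (intro mult_mono) auto
      with K[of z] show "onorm (frechet_derivative f (at z)) \<le> max K 0 * (1 + R ^ k)" by linarith
      show "(f has_derivative frechet_derivative f (at z)) (at z within cball 0 R)"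
        using assms(2)[of z] by (auto simp: frechet_derivative_works intro: has_derivative_at_withinI)
    qed (use xy in auto)
    then show "\<bar>f x - f y\<bar> \<le> max K 0 * (1 + R ^ k) * norm (x - y)" by simp
  qed simp
qed

lemma brownian_noise_continuous:
  fixes A :: "real^'d^'m"
  assumes "brownian_motion M T F W" "\<omega> \<in> space M"
  shows "continuous_on {0..T} (\<lambda>t. A *v (W t \<omega> - W 0 \<omega>))"
proof -
  have "continuous_on {0..T} (\<lambda>t. W t \<omega>)" using assms by (simp add: brownian_motion_def)
  then show ?thesis
    by (intro bounded_linear.continuous_on[OF matrix_vector_mul_bounded_linear] continuous_intros)
qed

text \<open>Every summand of the dominating variable has a moment bound independent of the grid: the
  \<open>N\<close> grid terms carry the weight \<open>h\<close>, and
  \<open>h * real N = T\<close>.\<close>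

lemma brownian_error_moments:
  fixes W :: "real \<Rightarrow> 'a \<Rightarrow> real^'d" and A :: "real^'d^'m" and p0 q0 :: "'a \<Rightarrow> real^'m"
  assumes M: "prob_space M" and F: "normal_filtration M T F" and W: "brownian_motion M T F W"
    and T: "0 < T" and r: "0 < r"
    and p0: "p0 \<in> borel_measurable M" and q0: "q0 \<in> borel_measurable M"
    and int: "integrable M (\<lambda>\<omega>. norm (p0 \<omega>, q0 \<omega>) ^ r)"
  obtains c where "0 \<le> c" "\<And>h N n. 0 < h \<Longrightarrow> h * real N = T \<Longrightarrow> n \<le> N \<Longrightarrow>
      moment_le M r c (\<lambda>\<omega>. 1 + norm (p0 \<omega>) + norm (q0 \<omega>) + noise_size (\<lambda>t. A *v (W t \<omega> - W 0 \<omega>)) h N n)"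
proof -
  interpret prob_space M by fact
  define w where "w t \<omega> = A *v (W t \<omega> - W 0 \<omega>)" for t \<omega>
  obtain c where c: "\<And>t. t \<in> {0..T} \<Longrightarrow> moment_le M r c (\<lambda>\<omega>. norm (w t \<omega>))"
    and cs: "\<And>h n u. 0 \<le> u \<Longrightarrow> u < h \<Longrightarrow> real n * h \<le> T \<Longrightarrow>
       moment_le M r c (\<lambda>\<omega>. norm (\<Sum>i<n. w (real i * h + u) \<omega> - w (real i * h + h) \<omega>))"
    using brownian_noise_moments[OF M F W T r, of A] unfolding w_def by blast
  have cw: "continuous_on {0..T} (\<lambda>t. w t \<omega>)" if "\<omega> \<in> space M" for \<omega>
    unfolding w_def by (rule brownian_noise_continuous[OF W that])
  have c0: "0 \<le> c" using moment_leD(3)[OF c[of 0]] T by simp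
  define e where "e = (LINT \<omega>|M. norm (p0 \<omega>, q0 \<omega>) ^ r)"
  have init: "moment_le M r e (\<lambda>\<omega>. norm (p0 \<omega>, q0 \<omega>))"
  proof -
    have "(\<lambda>\<omega>. norm (p0 \<omega>, q0 \<omega>)) \<in> borel_measurable M" using p0 q0 by simp
    then show ?thesis using int
      by (auto simp: moment_le_def e_def nn_integral_eq_integral intro!: integral_nonneg_AE)
  qed
  have p0m: "moment_le M r e (\<lambda>\<omega>. norm (p0 \<omega>))" and q0m: "moment_le M r e (\<lambda>\<omega>. norm (q0 \<omega>))"
    using p0 q0 norm_fst_le[of "p0 _" "q0 _"] norm_snd_le[of "q0 _" "p0 _"]
    by (auto intro!: moment_le_mono[OF init])
  define d where "d = T ^ r * c"
  \<comment> \<open>\<open>?D\<close> is the constant produced by adding two variables; its nesting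
    in \<open>C\<close> mirrors the order of the summands in the dominating variable.\<close>
  let ?D = "\<lambda>x y. 2 ^ r * (x + y)"
  define C where "C = ?D (?D (?D 1 e) e) (?D (?D (?D (?D c d) d) d) c)"
  have moment: "moment_le M r C (\<lambda>\<omega>. 1 + norm (p0 \<omega>) + norm (q0 \<omega>) + noise_size (\<lambda>t. w t \<omega>) h N n)"
    if h: "0 < h" and N: "h * real N = T" and n: "n \<le> N" for h N n
  proof -
    have jT: "real j * h \<in> {0..T}" if "j \<le> N" for j
      using h that mult_right_mono[of "real j" "real N" h] N by (auto simp: mult.commute)
    have jT': "real j * h + h \<in> {0..T}" if "j < N" for j using jT[of "Suc j"] that by (simp add: algebra_simps)
    have avg: "moment_le M r c (\<lambda>\<omega>. mean_defect (\<lambda>t. w t \<omega>) h j)" if "j \<le> N" for j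
      unfolding mean_defect_def
    proof (rule moment_le_integral_average[OF h r cs])
      show "real j * h \<le> T" using jT[OF that] by simp
      fix \<omega> assume \<omega>: "\<omega> \<in> space M"
      have "continuous_on {0..h} (\<lambda>u. w (real i * h + u) \<omega>)" if "i < j" for i
      proof (rule continuous_on_compose2[OF cw[OF \<omega>]])
        show "(\<lambda>u. real i * h + u) ` {0..h} \<subseteq> {0..T}"
          using jT[of i] jT'[of i] that \<open>j \<le> N\<close> by auto
      qed (intro continuous_intros)
      then show "continuous_on {0..h} (\<lambda>u. norm (\<Sum>i<j. w (real i * h + u) \<omega> - w (real i * h + h) \<omega>))"
        by (intro continuous_intros) auto
    qed
    \<comment> \<open>Weight and number of summands combine to
      \<open>h ^ r * real N ^ r = T ^ r\<close>.\<close>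
    have grid: "moment_le M r d (\<lambda>\<omega>. h * (\<Sum>j<N. X j \<omega>))" if "\<And>j. j < N \<Longrightarrow> moment_le M r c (X j)" for X
    proof -
      have "moment_le M r (h ^ r * (real (card {..<N}) ^ r * c)) (\<lambda>\<omega>. h * (\<Sum>j<N. X j \<omega>))"
        using that h c0 r by (intro moment_le_scale moment_le_sum) auto
      then show ?thesis by (simp add: d_def flip: N mult.assoc power_mult_distrib)
    qed
    have timeint: "moment_le M r d (\<lambda>\<omega>. integral {0..T} (\<lambda>s. norm (w s \<omega>)))"
    proof -
      have "moment_le M r (T ^ r * c) (\<lambda>\<omega>. T * (integral {0..T} (\<lambda>s. norm (w s \<omega>)) / T))"
        using T r c cw by (intro moment_le_scale moment_le_integral_average continuous_intros) auto
      then show ?thesis using T by (simp add: d_def)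
    qed
    show ?thesis unfolding C_def noise_size_def N
      by (intro moment_le_add r moment_le_one p0m q0m c jT n timeint grid jT' avg less_imp_le)
  qed
  show ?thesis
  proof (rule that)
    \<comment> \<open>Any admissible grid shows this; the one with a single step of length
      \<open>T\<close> always exists.\<close>
    show "0 \<le> C" using moment_leD(3)[OF moment[of T 1 0]] T by simp
  qed (rule moment[unfolded w_def])
qed

theorem theorem6:
  fixes M :: "'a measure"
    and T :: real
    and F :: "real \<Rightarrow> 'a measure"
    and W :: "real \<Rightarrow> 'a \<Rightarrow> real^'d"
    and V :: "real^'m \<Rightarrow> real"
    and dV :: "real^'m \<Rightarrow> real^'m"
    and \<Sigma> :: "real^'d^'m"
    and p0 q0 :: "'a \<Rightarrow> real^'m"
    and p q :: "real \<Rightarrow> 'a \<Rightarrow> real^'m"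
    and f :: "(real^'m) \<times> (real^'m) \<Rightarrow> real"
    and k :: nat
  assumes "T > 0"
    and "prob_space M"
    and "normal_filtration M T F"
    and "brownian_motion M T F W"
    and "smooth V"
    and "\<And>x. GDERIV V x :> dV x"
    and "p0 \<in> borel_measurable (F 0)" and "q0 \<in> borel_measurable (F 0)"
    and "integrable M (\<lambda>\<omega>. hamiltonian V (p0 \<omega>) (q0 \<omega>))"
    and "\<exists>L. L-lipschitz_on UNIV dV"
    and "sde_solution M T F W dV \<Sigma> p0 q0 p q"
    and "\<And>x. f differentiable (at x)"
    and "derivative_poly_growth k f"
    and "integrable M (\<lambda>\<omega>. norm (p0 \<omega>, q0 \<omega>) ^ (k + 1))"
  shows "\<exists>C>0. \<exists>hstar>0. \<forall>h N Psi P Q.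
           0 < h \<and> h \<le> hstar \<and> h * real N = T \<and>
           drift_preserving_scheme M W dV \<Sigma> p0 q0 h N Psi P Q \<longrightarrow>
           (\<forall>n\<in>{1..N}.
              integrable M (\<lambda>\<omega>. f (p (real n * h) \<omega>, q (real n * h) \<omega>)) \<and>
              integrable M (\<lambda>\<omega>. f (P n \<omega>, Q n \<omega>)) \<and>
              \<bar>prob_space.expectation M (\<lambda>\<omega>. f (p (real n * h) \<omega>, q (real n * h) \<omega>))
                 - prob_space.expectation M (\<lambda>\<omega>. f (P n \<omega>, Q n \<omega>))\<bar> \<le> C * h)"
proof -
  interpret prob_space M by fact
  note T = assms(1) and filt = assms(3) and brown = assms(4) and sde = assms(11)[unfolded sde_solution_def]
  define w where "w t \<omega> = \<Sigma> *v (W t \<omega> - W 0 \<omega>)" for t \<omega>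
  obtain L where "L-lipschitz_on UNIV dV" using assms(10) by blast
  then have lip: "(max L 1)-lipschitz_on UNIV dV" by (rule lipschitz_on_mono) auto
  define l where "l = max L 1"
  note lip = lip[folded l_def]
  have l: "1 \<le> l" by (simp add: l_def)
  obtain K where K: "0 \<le> K" "\<And>R x y. norm x \<le> R \<Longrightarrow> norm y \<le> R \<Longrightarrow> \<bar>f x - f y\<bar> \<le> K * (1 + R ^ k) * norm (x - y)"
    by (rule derivative_poly_growth_lipschitz[OF assms(13,12)]) blast
  have submeas: "X \<in> borel_measurable M" if "X \<in> borel_measurable (F t)" "t \<in> {0..T}" for X :: "'a \<Rightarrow> real^'m" and t
    using filt that by (intro measurable_from_subalg[OF _ that(1)]) (simp add: normal_filtration_def)
  have fm: "f \<in> borel_measurable borel"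
    using assms(12) by (intro borel_measurable_continuous_onI differentiable_imp_continuous_on) (simp add: differentiable_on_def differentiable_at_withinI)
  have init: "p0 \<in> borel_measurable M" "q0 \<in> borel_measurable M"
    using assms(7,8) T by (auto intro: submeas[of _ 0])
  obtain C where C: "0 < C" and path:
    "\<And>h N n p q w P Q Psi. \<lbrakk>0 < h; h \<le> 1; h * l \<le> 1; h * real N = T; n \<le> N;
      perturbed_solution T dV w p q; perturbed_scheme dV w h N Psi P Q; P 0 = p 0; Q 0 = q 0\<rbrakk>
     \<Longrightarrow> norm (p (real n * h), q (real n * h)) \<le> C * (1 + norm (p 0) + norm (q 0) + noise_size w h N n) \<and>
         norm ((p (real n * h), q (real n * h)) - (P n, Q n)) \<le> C * h * (1 + norm (p 0) + norm (q 0) + noise_size w h N n)"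
    by (rule drift_preserving_pathwise[OF lip l T]) blast
  define Z where "Z h N n \<omega> = 1 + norm (p0 \<omega>) + norm (q0 \<omega>) + noise_size (\<lambda>t. w t \<omega>) h N n" for h N n \<omega>
  obtain c where c: "0 \<le> c" and Zc: "\<And>h N n. 0 < h \<Longrightarrow> h * real N = T \<Longrightarrow> n \<le> N \<Longrightarrow> moment_le M (k + 1) c (Z h N n)"
    unfolding Z_def w_def by (rule brownian_error_moments[OF assms(2) filt brown T _ init assms(14), of \<Sigma>]) auto
  \<comment> \<open>Both states lie in the ball of radius \<open>2 * C * Z\<close>. As
    \<open>1 <= Z\<close>, the Lipschitz constant of \<open>f\<close> there is at most
    \<open>K * (1 + (2 * C) ^ k) * Z ^ k\<close>; times the error \<open>C * h * Z\<close> this is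
    \<open>B * h * Z ^ (k + 1)\<close>.\<close>
  define B where "B = K * (1 + (2 * C) ^ k) * C"
  have B: "0 \<le> B" unfolding B_def using K C by (intro mult_nonneg_nonneg) auto
  have cw: "continuous_on {0..T} (\<lambda>t. w t \<omega>)" if "\<omega> \<in> space M" for \<omega>
    unfolding w_def by (rule brownian_noise_continuous[OF brown that])
  have main: "integrable M (\<lambda>\<omega>. f (p (real n * h) \<omega>, q (real n * h) \<omega>)) \<and>
              integrable M (\<lambda>\<omega>. f (P n \<omega>, Q n \<omega>)) \<and>
              \<bar>expectation (\<lambda>\<omega>. f (p (real n * h) \<omega>, q (real n * h) \<omega>))
                 - expectation (\<lambda>\<omega>. f (P n \<omega>, Q n \<omega>))\<bar> \<le> (B * c + 1) * h"
    if h: "0 < h" "h \<le> min 1 (1 / l)" and N: "h * real N = T" and n: "n \<le> N"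
      and scheme: "drift_preserving_scheme M W dV \<Sigma> p0 q0 h N Psi P Q" for h N Psi P Q n
  proof -
    let ?x = "\<lambda>\<omega>. (p (real n * h) \<omega>, q (real n * h) \<omega>)" and ?y = "\<lambda>\<omega>. (P n \<omega>, Q n \<omega>)"
    let ?Z = "Z h N n"
    note Zm = Zc[OF h(1) N n]
    have h1: "h \<le> 1" using h by simp
    have hl: "h * l \<le> 1" using h l by (simp add: field_simps)
    have nT: "real n * h \<in> {0..T}"
      using h n mult_right_mono[of "real n" "real N" h] N by (auto simp: mult.commute)
    have wdiff: "\<Sigma> *v (W t \<omega> - W s \<omega>) = w t \<omega> - w s \<omega>" for s t \<omega>
      by (simp add: w_def flip: matrix_vector_mult_diff_distrib)
    \<comment> \<open>The scheme holds almost surely for each step; finitely many exceptional sets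
      are merged into one.\<close>
    have step: "AE \<omega> in M. \<forall>j\<in>{..<N}.
        let \<Delta> = w (real (Suc j) * h) \<omega> - w (real j * h) \<omega>;
            I = integral {0..1} (\<lambda>s. dV (Q j \<omega> + (s * h) *\<^sub>R Psi (Suc j) \<omega>))
        in Psi (Suc j) \<omega> = P j \<omega> + \<Delta> - (h / 2) *\<^sub>R I \<and>
           Q (Suc j) \<omega> = Q j \<omega> + h *\<^sub>R Psi (Suc j) \<omega> \<and>
           P (Suc j) \<omega> = P j \<omega> + \<Delta> - h *\<^sub>R I"
      using scheme unfolding drift_preserving_scheme_def Let_def wdiff by (intro AE_finite_allI) blast+
    have start: "AE \<omega> in M. P 0 \<omega> = p0 \<omega> \<and> Q 0 \<omega> = q0 \<omega>"
      using scheme unfolding drift_preserving_scheme_def by blast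
    have pathwise: "AE \<omega> in M. norm (?x \<omega>) \<le> C * ?Z \<omega> \<and> norm (?x \<omega> - ?y \<omega>) \<le> C * h * ?Z \<omega>"
      using conjunct2[OF sde] step start AE_space
    proof eventually_elim
      case (elim \<omega>)
      \<comment> \<open>At time 0 the integrals and the noise vanish in the integral
        equations.\<close>
      have p00: "p 0 \<omega> = p0 \<omega>" and q00: "q 0 \<omega> = q0 \<omega>" using elim(1) T by (force simp: matrix_vector_mult_0_right)+
      have sol: "perturbed_solution T dV (\<lambda>t. w t \<omega>) (\<lambda>t. p t \<omega>) (\<lambda>t. q t \<omega>)"
        unfolding perturbed_solution_def p00 q00
      proof (intro conjI ballI)
        show "continuous_on {0..T} (\<lambda>t. p t \<omega>)" "continuous_on {0..T} (\<lambda>t. q t \<omega>)" using elim(1) by blast+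
        show "continuous_on {0..T} (\<lambda>t. w t \<omega>)" using elim(4) by (rule cw)
        show "w 0 \<omega> = 0" by (simp add: w_def)
        fix t assume t: "t \<in> {0..T}"
        note eqs = bspec[OF conjunct2[OF conjunct2[OF elim(1)]] t]
        show "q t \<omega> = q0 \<omega> + integral {0..t} (\<lambda>s. p s \<omega>)" by (rule conjunct1[OF eqs])
        show "p t \<omega> = p0 \<omega> - integral {0..t} (\<lambda>s. dV (q s \<omega>)) + w t \<omega>"
          unfolding w_def by (rule conjunct2[OF eqs])
      qed
      have sch: "perturbed_scheme dV (\<lambda>t. w t \<omega>) h N (\<lambda>j. Psi j \<omega>) (\<lambda>j. P j \<omega>) (\<lambda>j. Q j \<omega>)"
        unfolding perturbed_scheme_def using elim(2) by blast
      show ?case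
        using path[OF h(1) h1 hl N n sol sch] elim(3) by (simp add: Z_def p00 q00)
    qed
    have Z1: "1 \<le> ?Z \<omega>" if "\<omega> \<in> space M" for \<omega>
      using noise_size_nonneg[OF h(1) n, of "\<lambda>t. w t \<omega>"] cw[OF that] by (simp add: Z_def N)
    have bounds: "AE \<omega> in M. \<bar>f (?x \<omega>)\<bar> \<le> (\<bar>f 0\<bar> + 2 * B) * ?Z \<omega> ^ (k + 1) \<and> \<bar>f (?y \<omega>)\<bar> \<le> (\<bar>f 0\<bar> + 2 * B) * ?Z \<omega> ^ (k + 1)
        \<and> \<bar>f (?x \<omega>) - f (?y \<omega>)\<bar> \<le> B * h * ?Z \<omega> ^ (k + 1)"
      using pathwise AE_space
    proof eventually_elim
      case (elim \<omega>)
      let ?z = "?Z \<omega>" and ?R = "2 * C * ?Z \<omega>"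
      have z: "1 \<le> ?z" by (rule Z1[OF elim(2)])
      \<comment> \<open>The numerical state is bounded by the exact state plus the error, with
        \<open>h <= 1\<close>; this replaces a separate stability estimate for the scheme.\<close>
      have "C * h * ?z \<le> C * 1 * ?z" using h1 C z by (intro mult_right_mono mult_left_mono) auto
      then have y: "norm (?y \<omega>) \<le> ?R"
        using elim(1) norm_triangle_sub[of "?y \<omega>" "?x \<omega>", unfolded norm_minus_commute[of "?y \<omega>" "?x \<omega>"]]
        by linarith
      have R: "0 \<le> ?R" using C z by simp
      with elim(1) have x: "norm (?x \<omega>) \<le> ?R" by linarith
      have zk: "1 \<le> ?z ^ k" using z by simp
      have growth: "K * (1 + ?R ^ k) * a \<le> K * (1 + (2 * C) ^ k) * ?z ^ k * a" if "0 \<le> a" for a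
      proof -
        have "1 + ?R ^ k \<le> ?z ^ k + (2 * C) ^ k * ?z ^ k" using zk by (simp add: power_mult_distrib)
        then have "K * (1 + ?R ^ k) * a \<le> K * (?z ^ k + (2 * C) ^ k * ?z ^ k) * a"
          using K that by (intro mult_right_mono mult_left_mono) auto
        then show ?thesis by (simp add: algebra_simps)
      qed
      \<comment> \<open>Comparing with \<open>f 0\<close> costs the distance
        \<open>2 * C * Z\<close> instead of \<open>C * h * Z\<close>, hence \<open>2 * B\<close>.
        This is the integrable majorant for both expectations.\<close>
      have size: "\<bar>f v\<bar> \<le> (\<bar>f 0\<bar> + 2 * B) * ?z ^ (k + 1)" if v: "norm v \<le> ?R" for v
      proof -
        have "\<bar>f v - f 0\<bar> \<le> K * (1 + ?R ^ k) * norm (v - 0)" using v R by (intro K) auto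
        also have "\<dots> \<le> K * (1 + ?R ^ k) * ?R" using v K R by (intro mult_left_mono) auto
        also have "\<dots> \<le> K * (1 + (2 * C) ^ k) * ?z ^ k * ?R" using R by (rule growth)
        also have "\<dots> = 2 * B * ?z ^ (k + 1)" by (simp add: B_def algebra_simps)
        finally have "\<bar>f v - f 0\<bar> \<le> 2 * B * ?z ^ (k + 1)" .
        moreover have "\<bar>f 0\<bar> * 1 \<le> \<bar>f 0\<bar> * ?z ^ (k + 1)" using one_le_power[OF z, of "k + 1"] by (intro mult_left_mono) auto
        ultimately show ?thesis unfolding distrib_right by linarith
      qed
      have "\<bar>f (?x \<omega>) - f (?y \<omega>)\<bar> \<le> K * (1 + ?R ^ k) * norm (?x \<omega> - ?y \<omega>)" using x y by (rule K)
      also have "\<dots> \<le> K * (1 + (2 * C) ^ k) * ?z ^ k * norm (?x \<omega> - ?y \<omega>)" by (rule growth) simp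
      also have "\<dots> \<le> K * (1 + (2 * C) ^ k) * ?z ^ k * (C * h * ?z)"
        using elim(1) K C z by (intro mult_left_mono mult_nonneg_nonneg) auto
      also have "\<dots> = B * h * ?z ^ (k + 1)" by (simp add: B_def algebra_simps)
      finally show ?case using size[OF x] size[OF y] by blast
    qed
    note Zint = moment_le_integral[OF Zm]
    have meas: "(\<lambda>\<omega>. f (?x \<omega>)) \<in> borel_measurable M" "(\<lambda>\<omega>. f (?y \<omega>)) \<in> borel_measurable M"
    proof -
      have "p (real n * h) \<in> borel_measurable M" "q (real n * h) \<in> borel_measurable M"
        using sde nT by (auto intro: submeas[OF _ nT])
      then show "(\<lambda>\<omega>. f (?x \<omega>)) \<in> borel_measurable M"
        by (intro measurable_compose[OF borel_measurable_Pair fm])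
      have "P n \<in> borel_measurable M" "Q n \<in> borel_measurable M"
        using scheme n unfolding drift_preserving_scheme_def by blast+
      then show "(\<lambda>\<omega>. f (?y \<omega>)) \<in> borel_measurable M"
        by (intro measurable_compose[OF borel_measurable_Pair fm])
    qed
    have int: "integrable M (\<lambda>\<omega>. f (?x \<omega>))" "integrable M (\<lambda>\<omega>. f (?y \<omega>))"
    proof -
      note dom = Bochner_Integration.integrable_bound[OF integrable_mult_right[OF Zint(1), of "\<bar>f 0\<bar> + 2 * B"]]
      show "integrable M (\<lambda>\<omega>. f (?x \<omega>))"
        using bounds by (intro dom meas, eventually_elim) (metis abs_ge_self order_trans real_norm_def)
      show "integrable M (\<lambda>\<omega>. f (?y \<omega>))"
        using bounds by (intro dom meas, eventually_elim) (metis abs_ge_self order_trans real_norm_def)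
    qed
    have "\<bar>expectation (\<lambda>\<omega>. f (?x \<omega>)) - expectation (\<lambda>\<omega>. f (?y \<omega>))\<bar> = \<bar>expectation (\<lambda>\<omega>. f (?x \<omega>) - f (?y \<omega>))\<bar>"
      using int by simp
    also have "\<dots> \<le> expectation (\<lambda>\<omega>. \<bar>f (?x \<omega>) - f (?y \<omega>)\<bar>)" by (rule integral_abs_bound)
    also have "\<dots> \<le> expectation (\<lambda>\<omega>. B * h * ?Z \<omega> ^ (k + 1))"
    proof (rule integral_mono_AE)
      show "AE \<omega> in M. \<bar>f (?x \<omega>) - f (?y \<omega>)\<bar> \<le> B * h * ?Z \<omega> ^ (k + 1)"
        using bounds by eventually_elim blast
    qed (intro integrable_abs Bochner_Integration.integrable_diff int integrable_mult_right Zint(1))+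
    also have "\<dots> = B * h * expectation (\<lambda>\<omega>. ?Z \<omega> ^ (k + 1))" by simp
    also have "\<dots> \<le> B * h * c" using Zint(2) B h by (intro mult_left_mono) auto
    also have "\<dots> \<le> (B * c + 1) * h" using h by (simp add: algebra_simps)
    finally show ?thesis using int by blast
  qed
  show ?thesis
  proof (intro exI conjI allI impI ballI)
    \<comment> \<open>\<open>B * c\<close> may be zero; the added 1 makes the constant strictly
      positive.\<close>
    show "0 < B * c + 1" using B c by (simp add: add_nonneg_pos)
    \<comment> \<open>The threshold encodes the two smallness conditions \<open>h <= 1\<close> and
      \<open>h * l <= 1\<close> of the pathwise analysis.\<close>
    show "0 < min 1 (1 / l)" using l by simp
    fix h N Psi P Q n
    assume *: "0 < h \<and> h \<le> min 1 (1 / l) \<and> h * real N = T \<and> drift_preserving_scheme M W dV \<Sigma> p0 q0 h N Psi P Q"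
      and "n \<in> {1..N}"
    then have "n \<le> N" by simp
    note result = main[OF conjunct1[OF *] conjunct1[OF conjunct2[OF *]] conjunct1[OF conjunct2[OF conjunct2[OF *]]]
        this conjunct2[OF conjunct2[OF conjunct2[OF *]]]]
    show "integrable M (\<lambda>\<omega>. f (p (real n * h) \<omega>, q (real n * h) \<omega>))" by (rule conjunct1[OF result])
    show "integrable M (\<lambda>\<omega>. f (P n \<omega>, Q n \<omega>))" by (rule conjunct1[OF conjunct2[OF result]])
    show "\<bar>expectation (\<lambda>\<omega>. f (p (real n * h) \<omega>, q (real n * h) \<omega>))
                 - expectation (\<lambda>\<omega>. f (P n \<omega>, Q n \<omega>))\<bar> \<le> (B * c + 1) * h"
      by (rule conjunct2[OF conjunct2[OF result]])
  qed
qed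

end
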